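(* Let $u_0,u_1$ be positive continuous functions on $\mathbb{R}^\nu$ and let $H_0,H_1$ be the operators on $L^2(\mathbb{R}^\nu)$ having the ground state representations $$\langle gu_i,H_i\,gu_i\rangle=\int|\nabla g|^2u_i^2\,d^\nu x,\qquad i=0,1.$$ Suppose $$0<\inf\Bigl(\frac{u_0}{u_1}\Bigr)\le\sup\Bigl(\frac{u_0}{u_1}\Bigr)<\infty$$ and let $$\beta=\left[\frac{\sup(u_0/u_1)}{\inf(u_0/u_1)}\right]^2 .$$ Then for any $V\le0$ and every $j\ge1$, $$|E_j(V_0;V)|\le|E_j(V_1;\beta V)|.$$
   Context: For $i=0,1$, $H_i$ (formally $H_i=-\Delta+V_i$ with $(-\Delta+V_i)u_i=0$) is the nonnegative self-adjoint operator on $L^2(\mathbb{R}^\nu)$ associated with the closed quadratic form with domain $\{gu_i: g\in L^2(\mathbb{R}^\nu,u_i^2\,dx),\ \nabla g\in L^2(\mathbb{R}^\nu,u_i^2\,dx)\}$ ($\nabla g$ the distributional gradient) and value $\int|\nabla g|^2u_i^2\,d^\nu x$ at $gu_i$. (The paper allows this representation to be taken as the definition of $H_i$. It holds if $V_i$ has positive part in $L^1_{\rm loc}$ and negative part in the Kato class $K_\nu$, $H_i$ is the form closure of $-\Delta+V_i$ on $C_0^\infty$, and $u_i$ is a positive distributional solution.) For measurable $V\le 0$ and $t>0$, $H_i+tV$ is the form sum on the form domain of $H_i$; it is tacitly assumed that $V$ is such that the quadratic forms of the operators $H_0+V$ and $H_1+\beta V$ are well defined on those domains, closed and bounded below. For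 $j=1,2,\dots$ and a potential $W$, $$E_j(V_i;W)=\min\bigl(0,\ \inf\{\lambda:\dim\operatorname{Ran}P_{(-\infty,\lambda]}(H_i+W)\ge j\}\bigr),$$ where $P_I(\cdot)$ denotes spectral projections; i.e. the $j$-th negative eigenvalue of $H_i+W$ or $0$. *)

theory Defs
  imports "HOL-Analysis.Analysis"
begin

section \<open>The Hilbert space of square-integrable functions\<close>

text \<open>Elements of \<open>L\<^sup>2\<close> are represented by complex-valued functions; two of them are
  the same vector iff they agree almost everywhere.\<close>

definition L2 :: "(real^'n \<Rightarrow> complex) set" where
  "L2 = {f \<in> borel_measurable lebesgue. integrable lebesgue (\<lambda>x. (cmod (f x))\<^sup>2)}"

definition ip :: "(real^'n \<Rightarrow> complex) \<Rightarrow> (real^'n \<Rightarrow> complex) \<Rightarrow> complex" where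
  "ip f h = (LINT x|lebesgue. cnj (f x) * h x)"

definition L2norm :: "(real^'n \<Rightarrow> complex) \<Rightarrow> real" where
  "L2norm f = sqrt (LINT x|lebesgue. (cmod (f x))\<^sup>2)"

definition ae_eq :: "(real^'n \<Rightarrow> complex) \<Rightarrow> (real^'n \<Rightarrow> complex) \<Rightarrow> bool" where
  "ae_eq f h \<longleftrightarrow> (AE x in lebesgue. f x = h x)"

text \<open>\<open>S\<close> contains \<open>j\<close> vectors that are linearly independent over the complex numbers in
  \<open>L\<^sup>2\<close>, i.e. modulo null functions; for a subspace this says that its (possibly infinite)
  dimension is at least \<open>j\<close>.\<close>

definition dim_ge :: "(real^'n \<Rightarrow> complex) set \<Rightarrow> nat \<Rightarrow> bool" where
  "dim_ge S j \<longleftrightarrow> (\<exists>v :: nat \<Rightarrow> real^'n \<Rightarrow> complex. (\<forall>i<j. v i \<in> S) \<and>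
     (\<forall>c :: nat \<Rightarrow> complex. ae_eq (\<lambda>x. \<Sum>i<j. c i * v i x) (\<lambda>x. 0) \<longrightarrow> (\<forall>i<j. c i = 0)))"


section \<open>Distributional gradients\<close>

definition partial :: "'n \<Rightarrow> (real^'n \<Rightarrow> real) \<Rightarrow> real^'n \<Rightarrow> real" where
  "partial i \<phi> x = frechet_derivative \<phi> (at x) (axis i 1)"

primrec Ck :: "nat \<Rightarrow> (real^'n \<Rightarrow> real) \<Rightarrow> bool" where
  "Ck 0 \<phi> = continuous_on UNIV \<phi>"
| "Ck (Suc k) \<phi> = ((\<forall>x. \<phi> differentiable (at x)) \<and> (\<forall>i. Ck k (partial i \<phi>)))"

definition test_function :: "(real^'n \<Rightarrow> real) \<Rightarrow> bool" where
  "test_function \<phi> \<longleftrightarrow> (\<forall>k. Ck k \<phi>) \<and> compact (closure {x. \<phi> x \<noteq> 0})"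

definition locally_integrable :: "(real^'n \<Rightarrow> complex) \<Rightarrow> bool" where
  "locally_integrable f \<longleftrightarrow> (\<forall>K. compact K \<longrightarrow> set_integrable lebesgue K f)"

definition has_dist_grad :: "(real^'n \<Rightarrow> complex) \<Rightarrow> (real^'n \<Rightarrow> complex^'n) \<Rightarrow> bool" where
  "has_dist_grad g G \<longleftrightarrow> locally_integrable g \<and> (\<forall>i. locally_integrable (\<lambda>x. G x $ i)) \<and>
     (\<forall>\<phi> i. test_function \<phi> \<longrightarrow>
        (LINT x|lebesgue. g x * complex_of_real (partial i \<phi> x)) =
        - (LINT x|lebesgue. G x $ i * complex_of_real (\<phi> x)))"

text \<open>The gradient is unique up to null sets, so the choice below does not affect any integral.\<close>

definition dist_grad :: "(real^'n \<Rightarrow> complex) \<Rightarrow> real^'n \<Rightarrow> complex^'n" where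
  "dist_grad g = (SOME G. has_dist_grad g G)"


section \<open>The quadratic forms\<close>

text \<open>The domain consists of the functions \<open>g u\<close> with \<open>g\<close> and its gradient in the space
  \<open>L\<^sup>2\<close> with weight \<open>u\<^sup>2\<close>.\<close>

definition form_dom :: "(real^'n \<Rightarrow> real) \<Rightarrow> (real^'n \<Rightarrow> complex) set" where
  "form_dom u = {f. \<exists>g. f = (\<lambda>x. g x * complex_of_real (u x)) \<and>
     g \<in> borel_measurable lebesgue \<and>
     integrable lebesgue (\<lambda>x. (cmod (g x))\<^sup>2 * (u x)\<^sup>2) \<and>
     (\<exists>G. has_dist_grad g G \<and> integrable lebesgue (\<lambda>x. (norm (G x))\<^sup>2 * (u x)\<^sup>2))}"

text \<open>The sesquilinear form of the form sum of \<open>H\<close> and \<open>W\<close>, where \<open>H\<close> has the ground state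
  representation with respect to \<open>u\<close>. On the diagonal its first term is the integral of the
  squared norm of the gradient of \<open>g = f / u\<close> with weight \<open>u\<^sup>2\<close>.\<close>

definition gs_form :: "(real^'n \<Rightarrow> real) \<Rightarrow> (real^'n \<Rightarrow> real) \<Rightarrow>
    (real^'n \<Rightarrow> complex) \<Rightarrow> (real^'n \<Rightarrow> complex) \<Rightarrow> complex" where
  "gs_form u W f h =
     (LINT x|lebesgue. (\<Sum>i\<in>UNIV. cnj (dist_grad (\<lambda>y. f y / complex_of_real (u y)) x $ i) *
                                  dist_grad (\<lambda>y. h y / complex_of_real (u y)) x $ i)
                       * complex_of_real ((u x)\<^sup>2))
   + (LINT x|lebesgue. complex_of_real (W x) * (cnj (f x) * h x))"

definition bounded_below_form ::
  "(real^'n \<Rightarrow> complex) set \<Rightarrow> ((real^'n \<Rightarrow> complex) \<Rightarrow> (real^'n \<Rightarrow> complex) \<Rightarrow> complex) \<Rightarrow> bool" where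
  "bounded_below_form Q q \<longleftrightarrow> (\<exists>c. \<forall>f\<in>Q. Re (q f f) \<ge> c * (L2norm f)\<^sup>2)"

definition closed_form ::
  "(real^'n \<Rightarrow> complex) set \<Rightarrow> ((real^'n \<Rightarrow> complex) \<Rightarrow> (real^'n \<Rightarrow> complex) \<Rightarrow> complex) \<Rightarrow> bool" where
  "closed_form Q q \<longleftrightarrow> (\<forall>F f. (\<forall>n::nat. F n \<in> Q) \<and> f \<in> L2 \<and>
       (\<lambda>n. L2norm (\<lambda>x. F n x - f x)) \<longlonglongrightarrow> 0 \<and>
       (\<forall>e>0. \<exists>N. \<forall>m\<ge>N. \<forall>n\<ge>N. \<bar>Re (q (\<lambda>x. F m x - F n x) (\<lambda>x. F m x - F n x))\<bar> < e)
     \<longrightarrow> f \<in> Q \<and> (\<lambda>n. Re (q (\<lambda>x. F n x - f x) (\<lambda>x. F n x - f x))) \<longlonglongrightarrow> 0)"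

definition admissible_potential :: "(real^'n \<Rightarrow> real) \<Rightarrow> (real^'n \<Rightarrow> real) \<Rightarrow> bool" where
  "admissible_potential u W \<longleftrightarrow> W \<in> borel_measurable lebesgue \<and>
     (\<forall>f\<in>form_dom u. integrable lebesgue (\<lambda>x. W x * (cmod (f x))\<^sup>2)) \<and>
     bounded_below_form (form_dom u) (gs_form u W) \<and>
     closed_form (form_dom u) (gs_form u W)"


section \<open>The associated operator and its spectral projections\<close>

text \<open>The operator associated with a form \<open>q\<close> with domain \<open>Q\<close> (first representation theorem),
  as a graph: \<open>f\<close> is mapped to \<open>h\<close> iff \<open>q \<phi> f\<close> is the inner product of \<open>\<phi>\<close> and \<open>h\<close>
  for all \<open>\<phi>\<close> in \<open>Q\<close>.\<close>

definition form_operator ::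
  "(real^'n \<Rightarrow> complex) set \<Rightarrow> ((real^'n \<Rightarrow> complex) \<Rightarrow> (real^'n \<Rightarrow> complex) \<Rightarrow> complex) \<Rightarrow>
   ((real^'n \<Rightarrow> complex) \<times> (real^'n \<Rightarrow> complex)) set" where
  "form_operator Q q = {(f, h). f \<in> Q \<and> h \<in> L2 \<and> (\<forall>\<phi>\<in>Q. q \<phi> f = ip \<phi> h)}"

definition schroedinger_op :: "(real^'n \<Rightarrow> real) \<Rightarrow> (real^'n \<Rightarrow> real) \<Rightarrow>
   ((real^'n \<Rightarrow> complex) \<times> (real^'n \<Rightarrow> complex)) set" where
  "schroedinger_op u W = form_operator (form_dom u) (gs_form u W)"

text \<open>Symmetry with respect to the inner product forces \<open>T\<close> to be linear and to respect
  almost-everywhere equality.\<close>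

definition orth_projection :: "((real^'n \<Rightarrow> complex) \<Rightarrow> (real^'n \<Rightarrow> complex)) \<Rightarrow> bool" where
  "orth_projection T \<longleftrightarrow> (\<forall>f\<in>L2. T f \<in> L2 \<and> ae_eq (T (T f)) (T f)) \<and>
     (\<forall>f\<in>L2. \<forall>h\<in>L2. ip (T f) h = ip f (T h))"

text \<open>The Stieltjes measure of \<open>t \<mapsto> \<langle>f, P t f\<rangle> = \<parallel>P t f\<parallel>\<^sup>2\<close>.\<close>

definition spectral_measure_at ::
  "(real \<Rightarrow> (real^'n \<Rightarrow> complex) \<Rightarrow> (real^'n \<Rightarrow> complex)) \<Rightarrow> (real^'n \<Rightarrow> complex) \<Rightarrow> real measure" where
  "spectral_measure_at P f = interval_measure (\<lambda>t. (L2norm (P t f))\<^sup>2)"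

text \<open>\<open>P\<close> is the (right-continuous) resolution of the identity of the operator \<open>A\<close>: \<open>P t\<close> is the
  spectral projection of \<open>A\<close> for the half line up to and including \<open>t\<close>, and \<open>A\<close> is the integral
  of \<open>t\<close> with respect to \<open>P\<close>. For self-adjoint \<open>A\<close> such a \<open>P\<close> exists, and is unique
  up to null functions, by the spectral theorem.
  The last clause determines \<open>A\<close> on its domain by polarization.\<close>

definition spectral_family ::
  "((real^'n \<Rightarrow> complex) \<times> (real^'n \<Rightarrow> complex)) set \<Rightarrow>
   (real \<Rightarrow> (real^'n \<Rightarrow> complex) \<Rightarrow> (real^'n \<Rightarrow> complex)) \<Rightarrow> bool" where
  "spectral_family A P \<longleftrightarrow>
     (\<forall>t. orth_projection (P t)) \<and>
     (\<forall>s t. \<forall>f\<in>L2. s \<le> t \<longrightarrow> ae_eq (P s (P t f)) (P s f)) \<and>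
     (\<forall>s. \<forall>f\<in>L2. ((\<lambda>t. L2norm (\<lambda>x. P t f x - P s f x)) \<longlongrightarrow> 0) (at_right s)) \<and>
     (\<forall>f\<in>L2. ((\<lambda>t. L2norm (P t f)) \<longlongrightarrow> 0) at_bot) \<and>
     (\<forall>f\<in>L2. ((\<lambda>t. L2norm (\<lambda>x. P t f x - f x)) \<longlongrightarrow> 0) at_top) \<and>
     Domain A = {f \<in> L2. integrable (spectral_measure_at P f) (\<lambda>t. t\<^sup>2)} \<and>
     (\<forall>(f, h)\<in>A. ip f h = complex_of_real (LINT t|spectral_measure_at P f. t))"

text \<open>The \<open>j\<close>-th negative eigenvalue, or \<open>0\<close>, of an operator with spectral family \<open>P\<close>. When the
  operator is bounded below and \<open>j > 0\<close>, the infimum is over a nonempty set that is bounded below,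
  since \<open>L\<^sup>2\<close> is infinite-dimensional.\<close>

definition neg_eigenvalue ::
  "(real \<Rightarrow> (real^'n \<Rightarrow> complex) \<Rightarrow> (real^'n \<Rightarrow> complex)) \<Rightarrow> nat \<Rightarrow> real" where
  "neg_eigenvalue P j = min 0 (Inf {l. dim_ge (P l ` L2) j})"

end

theory Submission
  imports Defs "HOL-Computational_Algebra.Polynomial"
begin

text \<open>Let \<open>m\<close> and \<open>M\<close> be the infimum and supremum of \<open>u\<^sub>0 / u\<^sub>1\<close>. The map \<open>g u\<^sub>0 \<mapsto> g u\<^sub>1\<close> keeps the
  gradient of \<open>g\<close>. It multiplies the kinetic energy and the squared norm by at most \<open>1 / m\<^sup>2\<close>, and
  for \<open>V \<le> 0\<close> the \<open>\<beta> V\<close>-energy of the image is at most the \<open>V\<close>-energy times \<open>1 / m\<^sup>2\<close>.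
  So a form bound by \<open>l \<le> 0\<close> times the squared norm on the spectral subspace of \<open>H\<^sub>0 + V\<close> for
  \<open>(-\<infinity>, l]\<close> survives on its image, and by min-max the spectral projections of
  \<open>H\<^sub>1 + \<beta> V\<close> beyond \<open>l\<close> have at least the same rank.\<close>

section \<open>Geometry of square-integrable functions\<close>

text \<open>Two obstacles shape the development. The form is built from \<open>dist_grad\<close>, an
  arbitrary choice of gradient, so even its additivity requires gradients to be unique up to null
  sets; bump functions and the fundamental lemma of the calculus of variations are developed for
  this. And \<open>spectral_family\<close> yields only diagonal form values on the operator domain,
  whereas min-max needs a lower bound for every vector of the form domain that is killed by a
  projection. The bound comes from slices \<open>P m f x - P n f x\<close>: they lie in the operator
  domain, their form values are integrals over \<open>{n<..m}\<close>, and additivity of such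
  integrals makes adjacent slices orthogonal for the form. The square of \<open>M / m\<close> has
  two sources: the numerator pays for passing between the weights in the potential term, the
  denominator matches the kinetic factor. Levels are nonpositive because the norm of the image is
  estimated from above only.\<close>

lemma borel_imp_lebesgue:
  fixes f :: "real^'n \<Rightarrow> 'b::topological_space"
  shows "f \<in> borel_measurable borel \<Longrightarrow> f \<in> borel_measurable lebesgue"
  by (simp add: borel_measurable_if_D measurable_completion)

lemma borel_measurable_cnj [measurable (raw)]:
  "f \<in> borel_measurable M \<Longrightarrow> (\<lambda>x. cnj (f x)) \<in> borel_measurable M"
  by (rule borel_measurable_continuous_on[where f = cnj]) (intro continuous_intros)

lemma integrable_mult_square:
  fixes a b :: "'a \<Rightarrow> complex"
  assumes [measurable]: "a \<in> borel_measurable M" "b \<in> borel_measurable M"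
    and "integrable M (\<lambda>x. (cmod (a x))\<^sup>2)" "integrable M (\<lambda>x. (cmod (b x))\<^sup>2)"
  shows "integrable M (\<lambda>x. a x * b x)"
proof (rule Bochner_Integration.integrable_bound)
  show "integrable M (\<lambda>x. (cmod (a x))\<^sup>2 + (cmod (b x))\<^sup>2)"
    using assms by simp
  have "cmod (a x) * cmod (b x) \<le> (cmod (a x))\<^sup>2 + (cmod (b x))\<^sup>2" for x
  proof -
    have "0 \<le> cmod (a x) * cmod (b x)" by simp
    then show ?thesis
      using sum_squares_bound[of "cmod (a x)" "cmod (b x)"] unfolding mult.assoc by linarith
  qed
  then show "AE x in M. norm (a x * b x) \<le> norm ((cmod (a x))\<^sup>2 + (cmod (b x))\<^sup>2)"
    by (simp add: norm_mult)
qed simp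

section \<open>Linear structure and inner product\<close>

lemma L2_measurable: "f \<in> L2 \<Longrightarrow> f \<in> borel_measurable lebesgue"
  by (simp add: L2_def)

lemma ip_integrable:
  assumes "f \<in> L2" "h \<in> L2"
  shows "integrable lebesgue (\<lambda>x. cnj (f x) * h x)"
  using assms by (intro integrable_mult_square) (auto simp: L2_def borel_measurable_cnj)

lemma L2_add:
  assumes "f \<in> L2" "h \<in> L2"
  shows "(\<lambda>x. f x + h x) \<in> L2"
proof -
  have [measurable]: "f \<in> borel_measurable lebesgue" "h \<in> borel_measurable lebesgue"
    using assms by (auto simp: L2_def)
  have "integrable lebesgue (\<lambda>x. (cmod (f x + h x))\<^sup>2)"
  proof (rule Bochner_Integration.integrable_bound)
    show "integrable lebesgue (\<lambda>x. 2 * (cmod (f x))\<^sup>2 + 2 * (cmod (h x))\<^sup>2)"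
      using assms by (simp add: L2_def)
    have "(cmod (f x + h x))\<^sup>2 \<le> 2 * (cmod (f x))\<^sup>2 + 2 * (cmod (h x))\<^sup>2" for x
    proof -
      have "(cmod (f x + h x))\<^sup>2 \<le> (cmod (f x) + cmod (h x))\<^sup>2"
        by (intro power_mono norm_triangle_ineq) simp
      then show ?thesis
        using sum_squares_bound[of "cmod (f x)" "cmod (h x)"] by (simp add: power2_sum)
    qed
    then show "AE x in lebesgue. norm ((cmod (f x + h x))\<^sup>2) \<le>
        norm (2 * (cmod (f x))\<^sup>2 + 2 * (cmod (h x))\<^sup>2)"
      by simp
  qed simp
  then show ?thesis by (simp add: L2_def)
qed

lemma L2_cmult: "f \<in> L2 \<Longrightarrow> (\<lambda>x. c * f x) \<in> L2"
  by (auto simp: L2_def norm_mult power_mult_distrib)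

lemma L2_diff:
  assumes "f \<in> L2" "h \<in> L2"
  shows "(\<lambda>x. f x - h x) \<in> L2"
  using L2_add[OF assms(1) L2_cmult[OF assms(2), of "-1"]] by simp

lemma L2_zero: "(\<lambda>x. 0) \<in> L2"
  by (simp add: L2_def)

lemma L2_sum:
  assumes "\<And>i. i \<in> I \<Longrightarrow> v i \<in> L2"
  shows "(\<lambda>x. \<Sum>i\<in>I. c i * v i x) \<in> L2"
  using assms by (induction I rule: infinite_finite_induct) (auto intro!: L2_zero L2_add L2_cmult)

lemma ip_add_right:
  assumes "f \<in> L2" "h \<in> L2" "k \<in> L2"
  shows "ip f (\<lambda>x. h x + k x) = ip f h + ip f k"
  using assms by (simp add: ip_def ring_distribs ip_integrable)

lemma ip_diff_right:
  assumes "f \<in> L2" "h \<in> L2" "k \<in> L2"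
  shows "ip f (\<lambda>x. h x - k x) = ip f h - ip f k"
  using assms by (simp add: ip_def ring_distribs ip_integrable)

lemma ip_cmult_right: "ip f (\<lambda>x. c * h x) = c * ip f h"
  by (simp add: ip_def mult.left_commute[of _ c])

lemma ip_cnj: "cnj (ip f h) = ip h f"
  by (simp add: ip_def flip: Bochner_Integration.integral_cnj) (simp add: mult.commute)

lemma ip_add_left:
  assumes "f \<in> L2" "h \<in> L2" "k \<in> L2"
  shows "ip (\<lambda>x. h x + k x) f = ip h f + ip k f"
  using ip_add_right[OF assms] by (metis ip_cnj complex_cnj_add)

lemma ip_diff_left:
  assumes "f \<in> L2" "h \<in> L2" "k \<in> L2"
  shows "ip (\<lambda>x. h x - k x) f = ip h f - ip k f"
  using ip_diff_right[OF assms] by (metis ip_cnj complex_cnj_diff)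

lemma ip_cmult_left: "ip (\<lambda>x. c * h x) f = cnj c * ip h f"
  using ip_cmult_right[of f c h] by (metis ip_cnj complex_cnj_mult)

section \<open>Equality almost everywhere and the norm\<close>

lemma ae_eq_refl [simp]: "ae_eq f f"
  by (simp add: ae_eq_def)

lemma ae_eq_sym:
  assumes "ae_eq f h"
  shows "ae_eq h f"
  using assms unfolding ae_eq_def by eventually_elim simp

lemma ae_eq_trans [trans]:
  assumes "ae_eq f h" "ae_eq h k"
  shows "ae_eq f k"
  using assms unfolding ae_eq_def by eventually_elim simp

lemma ae_eq_diff:
  assumes "ae_eq f f'" "ae_eq h h'"
  shows "ae_eq (\<lambda>x. f x - h x) (\<lambda>x. f' x - h' x)"
  using assms unfolding ae_eq_def by eventually_elim simp

lemma ae_eq_add: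
  assumes "ae_eq f f'" "ae_eq h h'"
  shows "ae_eq (\<lambda>x. f x + h x) (\<lambda>x. f' x + h' x)"
  using assms unfolding ae_eq_def by eventually_elim simp

lemma ip_cong:
  assumes "ae_eq f f'" "ae_eq h h'" "f \<in> L2" "f' \<in> L2" "h \<in> L2" "h' \<in> L2"
  shows "ip f h = ip f' h'"
  unfolding ip_def
proof (rule integral_cong_AE)
  show "AE x in lebesgue. cnj (f x) * h x = cnj (f' x) * h' x"
    using assms(1,2) unfolding ae_eq_def by eventually_elim simp
qed (use assms in \<open>auto dest!: L2_measurable intro: borel_measurable_times borel_measurable_cnj\<close>)

lemma L2norm_cong:
  assumes "ae_eq f f'" "f \<in> L2" "f' \<in> L2"
  shows "L2norm f = L2norm f'"
  unfolding L2norm_def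
proof (rule arg_cong[where f = sqrt], rule integral_cong_AE)
  show "AE x in lebesgue. (cmod (f x))\<^sup>2 = (cmod (f' x))\<^sup>2"
    using assms(1) unfolding ae_eq_def by eventually_elim simp
qed (use assms in \<open>auto dest!: L2_measurable intro: borel_measurable_times borel_measurable_cnj\<close>)

lemma L2norm_nonneg [simp]: "0 \<le> L2norm f"
  by (simp add: L2norm_def)

lemma L2norm_zero [simp]: "L2norm (\<lambda>x. 0) = 0"
  by (simp add: L2norm_def)

lemma L2norm_sq: "(L2norm f)\<^sup>2 = (LINT x|lebesgue. (cmod (f x))\<^sup>2)"
  by (simp add: L2norm_def)

lemma ip_self: "ip f f = complex_of_real ((L2norm f)\<^sup>2)"
  unfolding L2norm_sq ip_def
  by (subst integral_complex_of_real[symmetric])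
     (intro Bochner_Integration.integral_cong refl, metis complex_norm_square mult.commute)

lemma L2norm_eq_0_iff: "f \<in> L2 \<Longrightarrow> L2norm f = 0 \<longleftrightarrow> ae_eq f (\<lambda>x. 0)"
  unfolding L2norm_def ae_eq_def L2_def
  by (auto simp: integral_nonneg_eq_0_iff_AE)

lemma ip_zero_right:
  assumes "ae_eq h (\<lambda>x. 0)" "f \<in> L2" "h \<in> L2"
  shows "ip f h = 0"
  using ip_cong[OF ae_eq_refl assms(1) assms(2,2,3) L2_zero] by (simp add: ip_def)

lemma L2norm_cmult: "L2norm (\<lambda>x. c * f x) = cmod c * L2norm f"
  by (simp add: L2norm_def norm_mult power_mult_distrib real_sqrt_mult)

lemma cauchy_schwarz_ip:
  assumes "f \<in> L2" "h \<in> L2"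
  shows "cmod (ip f h) \<le> L2norm f * L2norm h"
proof (cases "L2norm h = 0")
  case True
  then show ?thesis using assms ip_zero_right L2norm_eq_0_iff by fastforce
next
  case False
  \<comment> \<open>The coefficient of the orthogonal projection of \<open>f\<close> onto
    \<open>h\<close>; with it the bracket multiplied by \<open>cnj c\<close> in the expansion below
    is zero.\<close>
  define c where "c = ip h f / complex_of_real ((L2norm h)\<^sup>2)"
  have ch: "(\<lambda>x. c * h x) \<in> L2" using assms by (simp add: L2_cmult)
  have d: "(\<lambda>x. f x - c * h x) \<in> L2" using assms ch by (simp add: L2_diff)
  have "complex_of_real ((L2norm (\<lambda>x. f x - c * h x))\<^sup>2)
      = ip f f - c * ip f h - cnj c * (ip h f - c * ip h h)"
    using assms ch d unfolding ip_self[symmetric]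
    by (simp add: ip_diff_left ip_diff_right ip_cmult_left ip_cmult_right)
  also have "ip h f - c * ip h h = 0"
    using False by (simp add: c_def ip_self)
  also have "c * ip f h = complex_of_real ((cmod (ip f h))\<^sup>2 / (L2norm h)\<^sup>2)"
    unfolding c_def of_real_divide complex_norm_square ip_cnj by simp
  finally have "(L2norm (\<lambda>x. f x - c * h x))\<^sup>2 = (L2norm f)\<^sup>2 - (cmod (ip f h))\<^sup>2 / (L2norm h)\<^sup>2"
    unfolding ip_self by (metis (no_types, lifting) mult_zero_right diff_zero of_real_diff of_real_eq_iff)
  then have "(cmod (ip f h))\<^sup>2 / (L2norm h)\<^sup>2 \<le> (L2norm f)\<^sup>2"
    by (metis diff_ge_0_iff_ge zero_le_power2)
  then have "(cmod (ip f h))\<^sup>2 \<le> (L2norm f * L2norm h)\<^sup>2"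
    using False by (simp add: field_simps power_mult_distrib)
  then show ?thesis by (rule power2_le_imp_le) simp
qed

lemma L2norm_add_sq:
  assumes "f \<in> L2" "h \<in> L2"
  shows "(L2norm (\<lambda>x. f x + h x))\<^sup>2 = (L2norm f)\<^sup>2 + (L2norm h)\<^sup>2 + 2 * Re (ip f h)"
proof -
  have "complex_of_real ((L2norm (\<lambda>x. f x + h x))\<^sup>2) = ip f f + ip h f + (ip f h + ip h h)"
    using assms unfolding ip_self[symmetric] by (simp add: ip_add_left ip_add_right L2_add)
  also have "ip h f = cnj (ip f h)" by (simp add: ip_cnj)
  finally have "Re (complex_of_real ((L2norm (\<lambda>x. f x + h x))\<^sup>2)) =
      Re (ip f f + cnj (ip f h) + (ip f h + ip h h))"
    by simp
  then show ?thesis by (simp add: ip_self)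
qed

lemma L2norm_triangle:
  assumes "f \<in> L2" "h \<in> L2"
  shows "L2norm (\<lambda>x. f x + h x) \<le> L2norm f + L2norm h"
proof -
  have "(L2norm (\<lambda>x. f x + h x))\<^sup>2 \<le> (L2norm f)\<^sup>2 + (L2norm h)\<^sup>2 + 2 * (L2norm f * L2norm h)"
    using cauchy_schwarz_ip[OF assms] complex_Re_le_cmod[of "ip f h"] L2norm_add_sq[OF assms] by simp
  then have "(L2norm (\<lambda>x. f x + h x))\<^sup>2 \<le> (L2norm f + L2norm h)\<^sup>2"
    by (simp add: power2_sum)
  then show ?thesis by (rule power2_le_imp_le) simp
qed

lemma L2norm_diff_commute: "L2norm (\<lambda>x. f x - h x) = L2norm (\<lambda>x. h x - f x)"
  by (simp add: L2norm_def norm_minus_commute)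

lemma L2norm_diff_bound:
  assumes "f \<in> L2" "h \<in> L2"
  shows "\<bar>L2norm f - L2norm h\<bar> \<le> L2norm (\<lambda>x. f x - h x)"
  using L2norm_triangle[OF L2_diff[OF assms] assms(2)]
    L2norm_triangle[OF L2_diff[OF assms(2,1)] assms(1)] L2norm_diff_commute[of f h]
  by simp

text \<open>Nondegeneracy of the inner product, tested on the difference of the two functions.
  Linearity and adjoint rules for the projections are obtained by moving them across
  \<open>ip\<close> and applying this.\<close>

lemma ae_eqI_ip:
  assumes "f \<in> L2" "h \<in> L2" and "\<And>k. k \<in> L2 \<Longrightarrow> ip f k = ip h k"
  shows "ae_eq f h"
proof -
  have d: "(\<lambda>x. f x - h x) \<in> L2" using assms by (simp add: L2_diff)
  have "ip (\<lambda>x. f x - h x) (\<lambda>x. f x - h x) = 0"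
    using assms(3)[OF d] by (simp add: ip_diff_left[OF d assms(1,2)])
  then have "L2norm (\<lambda>x. f x - h x) = 0" by (simp add: ip_self)
  then show ?thesis using L2norm_eq_0_iff[OF d] by (simp add: ae_eq_def)
qed

lemma L2norm_tendsto:
  assumes "(\<And>t. F t \<in> L2)" "f \<in> L2" "((\<lambda>t. L2norm (\<lambda>x. F t x - f x)) \<longlongrightarrow> 0) A"
  shows "((\<lambda>t. L2norm (F t)) \<longlongrightarrow> L2norm f) A"
proof -
  have "((\<lambda>t. L2norm (F t) - L2norm f) \<longlongrightarrow> 0) A"
    by (rule Lim_null_comparison[OF _ assms(3)]) (simp add: L2norm_diff_bound assms)
  then show ?thesis by (simp add: LIM_zero_iff)
qed

lemma ip_tendsto_left:
  assumes "(\<And>t. F t \<in> L2)" "f \<in> L2" "h \<in> L2" "((\<lambda>t. L2norm (\<lambda>x. F t x - f x)) \<longlongrightarrow> 0) A"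
  shows "((\<lambda>t. ip (F t) h) \<longlongrightarrow> ip f h) A"
proof -
  have "((\<lambda>t. ip (F t) h - ip f h) \<longlongrightarrow> 0) A"
  proof (rule Lim_null_comparison)
    show "((\<lambda>t. L2norm (\<lambda>x. F t x - f x) * L2norm h) \<longlongrightarrow> 0) A"
      using tendsto_mult_left_zero[OF assms(4)] .
    have "norm (ip (F t) h - ip f h) \<le> L2norm (\<lambda>x. F t x - f x) * L2norm h" for t
      using cauchy_schwarz_ip[OF L2_diff[OF assms(1,2)] assms(3), of t]
      by (simp add: ip_diff_left assms)
    then show "\<forall>\<^sub>F t in A. norm (ip (F t) h - ip f h) \<le> L2norm (\<lambda>x. F t x - f x) * L2norm h"
      by simp
  qed
  then show ?thesis by (simp add: LIM_zero_iff)
qed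

lemma L2norm_sum_le:
  assumes "finite I" "\<And>i. i \<in> I \<Longrightarrow> v i \<in> L2"
  shows "L2norm (\<lambda>x. \<Sum>i\<in>I. c i * v i x) \<le> (\<Sum>i\<in>I. cmod (c i) * L2norm (v i))"
  using assms
proof (induction I rule: finite_induct)
  case (insert i I)
  have "L2norm (\<lambda>x. c i * v i x + (\<Sum>i\<in>I. c i * v i x)) \<le>
      L2norm (\<lambda>x. c i * v i x) + L2norm (\<lambda>x. \<Sum>i\<in>I. c i * v i x)"
    using insert.prems by (intro L2norm_triangle L2_cmult L2_sum) simp_all
  then show ?case using insert by (simp add: L2norm_cmult)
qed simp

lemma ip_sum_right:
  assumes "finite I" "\<And>i. i \<in> I \<Longrightarrow> v i \<in> L2" "f \<in> L2"
  shows "ip f (\<lambda>x. \<Sum>i\<in>I. c i * v i x) = (\<Sum>i\<in>I. c i * ip f (v i))"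
  using assms
proof (induction I rule: finite_induct)
  case empty
  then show ?case by (simp add: ip_def)
next
  case (insert i I)
  have "ip f (\<lambda>x. c i * v i x + (\<Sum>i\<in>I. c i * v i x)) =
      ip f (\<lambda>x. c i * v i x) + ip f (\<lambda>x. \<Sum>i\<in>I. c i * v i x)"
    using insert.prems by (intro ip_add_right L2_cmult L2_sum) simp_all
  then show ?case using insert by (simp add: ip_cmult_right)
qed

text \<open>Indicators of unit cubes placed along the diagonal, with gaps that keep the closed cubes
  disjoint. They witness infinite dimension, which makes the set in \<open>neg_eigenvalue\<close>
  nonempty.\<close>

lemma orthonormal_sequence_exists:
  obtains e :: "nat \<Rightarrow> real^'n \<Rightarrow> complex"
  where "\<And>i. e i \<in> L2" "\<And>i k. ip (e i) (e k) = (if i = k then 1 else 0)"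
proof
  define B where "B i = (cbox (vec (2 * real i)) (vec (2 * real i + 1)) :: (real^'n) set)" for i :: nat
  define e where "e i x = complex_of_real (indicator (B i) x)" for i :: nat and x :: "real^'n"
  have B_sets: "B i \<in> sets lebesgue" for i by (simp add: B_def)
  have B_measure: "measure lebesgue (B i) = 1" for i
  proof -
    have "vec (2 * real i) \<in> B i" by (simp add: B_def mem_box_cart)
    then have "B i \<noteq> {}" by blast
    then have "measure lborel (B i) = (\<Prod>a\<in>UNIV. vec (2 * real i + 1) $ a - vec (2 * real i) $ (a :: 'n))"
      unfolding B_def by (rule content_cbox_cart)
    then show ?thesis by (simp add: B_def)
  qed
  have B_finite: "emeasure lebesgue (B i) < \<infinity>" for i
    using emeasure_lborel_cbox_finite[of "vec (2 * real i)" "vec (2 * real i + 1) :: real^'n"] by (simp add: B_def)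
  have B_int: "integrable lebesgue (\<lambda>x. indicat_real (B i) x)" for i
    using B_sets B_finite by (simp add: integrable_indicator_iff)
  have disj: "B i \<inter> B k = {}" if "i \<noteq> k" for i k
  proof -
    have "x \<notin> B k" if "x \<in> B i" for x
    proof
      assume "x \<in> B k"
      fix a :: 'n
      have "2 * real i \<le> x $ a" "x $ a \<le> 2 * real i + 1" "2 * real k \<le> x $ a" "x $ a \<le> 2 * real k + 1"
        using \<open>x \<in> B i\<close> \<open>x \<in> B k\<close> by (simp_all add: B_def mem_box_cart)
      then have "2 * real i < 2 * real (Suc k)" "2 * real k < 2 * real (Suc i)" by auto
      then show False using \<open>i \<noteq> k\<close> by simp
    qed
    then show ?thesis by blast
  qed
  show "e i \<in> L2" for i
  proof -
    have "(cmod (e i x))\<^sup>2 = indicator (B i) x" for x by (simp add: e_def indicator_def)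
    then show ?thesis using B_sets B_int unfolding L2_def
      by (simp add: e_def[abs_def])
  qed
  show "ip (e i) (e k) = (if i = k then 1 else 0)" for i k
  proof -
    have "cnj (e i x) * e k x = complex_of_real (if i = k then indicator (B i) x else 0)" for x
      using disj[of i k] by (auto simp: e_def indicator_def)
    then show ?thesis
      using B_sets B_measure by (simp only: ip_def integral_complex_of_real) simp
  qed
qed

section \<open>Uniqueness of distributional gradients\<close>

text \<open>This family contains \<open>exp (-1/t)\<close> and is closed under differentiation, so its members are
  smooth.\<close>

definition flat :: "real poly \<Rightarrow> real \<Rightarrow> real" where
  "flat p t = (if t > 0 then poly p (1 / t) * exp (- (1 / t)) else 0)"

lemma poly_times_exp_tendsto_0: "((\<lambda>y. poly p y * exp (- y)) \<longlongrightarrow> (0::real)) at_top"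
proof -
  have "((\<lambda>y. \<Sum>i\<le>degree p. coeff p i * (y ^ i / exp y)) \<longlongrightarrow> (\<Sum>i\<le>degree p. coeff p i * 0)) at_top"
    by (intro tendsto_intros tendsto_power_div_exp_0)
  then show ?thesis
    by (simp add: poly_altdef sum_distrib_right exp_minus divide_inverse mult.assoc)
qed

lemma flat_tendsto_0: "(flat p \<longlongrightarrow> 0) (at 0)"
proof -
  have "(flat p \<longlongrightarrow> 0) (at_right 0)"
  proof (rule Lim_transform_eventually)
    show "((\<lambda>t. poly p (inverse t) * exp (- inverse t)) \<longlongrightarrow> 0) (at_right 0)"
      by (rule filterlim_compose[OF poly_times_exp_tendsto_0 filterlim_inverse_at_top_right])
    show "\<forall>\<^sub>F t in at_right 0. poly p (inverse t) * exp (- inverse t) = flat p t"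
      using eventually_at_right_less[of 0] by eventually_elim (simp add: flat_def inverse_eq_divide)
  qed
  moreover have "(flat p \<longlongrightarrow> 0) (at_left 0)"
    by (rule Lim_transform_eventually[OF tendsto_const])
       (auto simp: flat_def eventually_at_filter)
  ultimately show ?thesis by (simp add: filterlim_split_at)
qed

text \<open>For positive \<open>t\<close> the chain rule produces \<open>p - pderiv p\<close> at
  \<open>1 / t\<close>, times the square of \<open>1 / t\<close>; the latter is absorbed as the
  polynomial \<open>[:0, 0, 1:]\<close>. At 0 the decay of the whole family is what counts.\<close>

lemma flat_has_derivative:
  "(flat p has_real_derivative flat ([:0, 0, 1:] * (p - pderiv p)) t) (at t)"
proof -
  consider "t > 0" | "t < 0" | "t = 0" by linarith
  then show ?thesis
  proof cases
    case 1
    have "((\<lambda>t. poly p (1 / t) * exp (- (1 / t))) has_real_derivative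
        flat ([:0, 0, 1:] * (p - pderiv p)) t) (at t)"
      using 1 by (auto intro!: derivative_eq_intros simp: flat_def field_simps power2_eq_square)
    then show ?thesis
      by (rule has_field_derivative_transform_within_open[where S = "{0<..}"])
         (use 1 in \<open>auto simp: flat_def\<close>)
  next
    case 2
    have "((\<lambda>t. 0) has_real_derivative flat ([:0, 0, 1:] * (p - pderiv p)) t) (at t)"
      using 2 by (simp add: flat_def)
    then show ?thesis
      by (rule has_field_derivative_transform_within_open[where S = "{..<0}"])
         (use 2 in \<open>auto simp: flat_def\<close>)
  next
    case 3
    \<comment> \<open>Dividing by \<open>h\<close> multiplies a polynomial in \<open>1 / h\<close>
      by its variable, so the difference quotient stays in the family. At \<open>h = 0\<close> both
      sides are 0, since division by 0 yields 0.\<close>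
    have "(\<lambda>h. (flat p (0 + h) - flat p 0) / h) = flat (pCons 0 p)"
      by (auto simp: flat_def fun_eq_iff)
    then show ?thesis
      using flat_tendsto_0[of "pCons 0 p"] unfolding 3 DERIV_def by (simp add: flat_def)
  qed
qed

section \<open>Calculus of the smoothness classes \<open>Ck\<close>\<close>

lemma partial_eqI: "(f has_derivative f') (at x) \<Longrightarrow> partial i f x = f' (axis i 1)"
  unfolding partial_def by (metis frechet_derivative_at)

text \<open>The product rule leaves one factor undifferentiated, so the induction for products has
  to lower the order. In the base case continuity comes from differentiability, as the successor
  clause of \<open>Ck\<close> does not list it.\<close>

lemma Ck_Suc_imp: "Ck (Suc k) f \<Longrightarrow> Ck k f"
proof (induction k arbitrary: f)
  case 0
  then show ?case
    by (auto intro!: differentiable_imp_continuous_on simp: differentiable_on_def)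
next
  case (Suc k)
  then show ?case by simp
qed

lemma Ck_const: "Ck k (\<lambda>x. c)"
proof (induction k arbitrary: c)
  case (Suc k)
  have "partial i (\<lambda>x. c) = (\<lambda>x. 0)" for i :: 'a
    using partial_eqI[OF has_derivative_const] by fastforce
  then show ?case using Suc by simp
qed simp

lemma Ck_add: "Ck k f \<Longrightarrow> Ck k h \<Longrightarrow> Ck k (\<lambda>x. f x + h x)"
proof (induction k arbitrary: f h)
  case 0
  then show ?case by (auto intro: continuous_on_add)
next
  case (Suc k)
  have "partial i (\<lambda>x. f x + h x) = (\<lambda>x. partial i f x + partial i h x)" for i
  proof
    fix x
    have "((\<lambda>x. f x + h x) has_derivative
        (\<lambda>v. frechet_derivative f (at x) v + frechet_derivative h (at x) v)) (at x)"
      using Suc.prems by (auto intro!: has_derivative_add simp: frechet_derivative_works[symmetric])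
    from partial_eqI[OF this] show "partial i (\<lambda>x. f x + h x) x = partial i f x + partial i h x"
      by (simp add: partial_def)
  qed
  then show ?case using Suc by simp
qed

lemma Ck_mult: "Ck k f \<Longrightarrow> Ck k h \<Longrightarrow> Ck k (\<lambda>x. f x * h x)"
proof (induction k arbitrary: f h)
  case 0
  then show ?case by (auto intro: continuous_on_mult)
next
  case (Suc k)
  have "partial i (\<lambda>x. f x * h x) = (\<lambda>x. f x * partial i h x + partial i f x * h x)" for i
  proof
    fix x
    have "((\<lambda>x. f x * h x) has_derivative
        (\<lambda>v. f x * frechet_derivative h (at x) v + frechet_derivative f (at x) v * h x)) (at x)"
      using Suc.prems by (auto intro!: has_derivative_mult simp: frechet_derivative_works[symmetric])
    from partial_eqI[OF this]
    show "partial i (\<lambda>x. f x * h x) x = f x * partial i h x + partial i f x * h x"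
      by (simp add: partial_def)
  qed
  then show ?case using Suc Ck_Suc_imp[OF Suc.prems(1)] Ck_Suc_imp[OF Suc.prems(2)]
    by (simp add: Ck_add)
qed

lemma Ck_prod: "(\<And>i. i \<in> I \<Longrightarrow> Ck k (f i)) \<Longrightarrow> Ck k (\<lambda>x. \<Prod>i\<in>I. f i x)"
  by (induction I rule: infinite_finite_induct) (auto intro!: Ck_const Ck_mult)

text \<open>Each derivative changes the polynomial, hence the induction over arbitrary
  \<open>p\<close>. Both signs of \<open>c\<close> are wanted: they give the rising and the falling
  edges of a bump.\<close>

lemma Ck_flat:
  fixes i :: "'n::finite"
  shows "Ck k (\<lambda>x::real^'n. flat p (c * x $ i + d))"
proof (induction k arbitrary: p)
  case 0
  have "continuous_on UNIV (flat p)"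
    by (metis DERIV_continuous_on flat_has_derivative has_field_derivative_at_within)
  then show ?case
    by (auto intro!: continuous_on_compose2[of UNIV "flat p"] continuous_intros)
next
  case (Suc k)
  let ?q = "[:0, 0, 1:] * (p - pderiv p)"
  have D: "((\<lambda>x::real^'n. flat p (c * x $ i + d)) has_derivative
        (\<lambda>v. c * v $ i * flat ?q (c * x $ i + d))) (at x)" for x
    using flat_has_derivative[of p "c * x $ i + d"] unfolding has_field_derivative_def
    by (rule has_derivative_compose[where f = "\<lambda>x. c * x $ i + d", rotated, THEN has_derivative_eq_rhs])
       (auto intro!: derivative_eq_intros bounded_linear_imp_has_derivative simp: mult_ac)
  have "partial j (\<lambda>x::real^'n. flat p (c * x $ i + d)) =
      (\<lambda>x. (c * axis j 1 $ i) * flat ?q (c * x $ i + d))" for j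
    using partial_eqI[OF D] by fastforce
  then have "Ck k (partial j (\<lambda>x::real^'n. flat p (c * x $ i + d)))" for j
    using Suc Ck_mult[OF Ck_const] by metis
  moreover have "(\<lambda>x::real^'n. flat p (c * x $ i + d)) differentiable (at x)" for x
    using D differentiable_def by blast
  ultimately show ?case by simp
qed

text \<open>For \<open>s > 0\<close> the scale changes the steepness of the edges but not the set
  where the bump vanishes, so growing \<open>s\<close> approximates the indicator of a fixed box.
  The arguments are spelled in the shape \<open>c * x $ i + d\<close> so that \<open>Ck_flat\<close>
  matches them.\<close>

definition box_bump :: "real^'n \<Rightarrow> real^'n \<Rightarrow> real \<Rightarrow> real^'n \<Rightarrow> real" where
  "box_bump a b s x =
     (\<Prod>i\<in>UNIV. flat 1 (s * x $ i + - s * a $ i) * flat 1 (- s * x $ i + s * b $ i))"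

lemma flat_1_bounds: "0 \<le> flat 1 t" "flat 1 t \<le> 1"
  by (auto simp: flat_def)

lemma box_bump_outside:
  assumes "x \<notin> box a b" "s > 0"
  shows "box_bump a b s x = 0"
proof -
  obtain i where i: "x $ i \<le> a $ i \<or> b $ i \<le> x $ i"
    using assms(1) by (auto simp: mem_box_cart not_less)
  then have "flat 1 (s * x $ i + - s * a $ i) * flat 1 (- s * x $ i + s * b $ i) = 0"
    using assms(2) by (auto simp: flat_def)
  then show ?thesis unfolding box_bump_def by (meson UNIV_I finite prod_zero)
qed

lemma test_function_box_bump:
  assumes "s > 0"
  shows "test_function (box_bump a b s)"
proof -
  have "Ck k (box_bump a b s)" for k
    unfolding box_bump_def by (intro Ck_prod Ck_mult Ck_flat)
  moreover have "{x. box_bump a b s x \<noteq> 0} \<subseteq> cbox a b"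
    using box_bump_outside[OF _ assms, of _ a b] box_subset_cbox[of a b] by blast
  then have "compact (closure {x. box_bump a b s x \<noteq> 0})"
    by (meson bounded_cbox bounded_subset compact_closure)
  ultimately show ?thesis by (simp add: test_function_def)
qed

lemma box_bump_bounds: "0 \<le> box_bump a b s x" "box_bump a b s x \<le> 1"
  unfolding box_bump_def
  by (intro prod_nonneg prod_le_1 ballI conjI mult_le_one mult_nonneg_nonneg flat_1_bounds)+

lemma flat_1_tendsto:
  assumes "r > 0"
  shows "(\<lambda>n. flat 1 (real (Suc n) * r)) \<longlonglongrightarrow> 1"
proof -
  have "(\<lambda>n. exp (- (inverse (real (Suc n)) * (1 / r)))) \<longlonglongrightarrow> exp (- (0 * (1 / r)))"
    by (intro tendsto_intros LIMSEQ_inverse_real_of_nat)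
  then show ?thesis using assms by (simp add: flat_def divide_simps)
qed

lemma box_bump_tendsto: "(\<lambda>n. box_bump a b (real (Suc n)) x) \<longlonglongrightarrow> indicat_real (box a b) x"
proof (cases "x \<in> box a b")
  case True
  have "(\<lambda>n. \<Prod>i\<in>UNIV. flat 1 (real (Suc n) * (x $ i - a $ i)) * flat 1 (real (Suc n) * (b $ i - x $ i)))
      \<longlonglongrightarrow> (\<Prod>i\<in>(UNIV::'a set). 1 * 1)"
    using True by (intro tendsto_prod tendsto_mult flat_1_tendsto) (auto simp: mem_box_cart)
  then show ?thesis using True by (simp add: box_bump_def algebra_simps)
next
  case False
  then show ?thesis by (simp add: box_bump_outside)
qed

section \<open>The fundamental lemma: from test functions to boxes to Lebesgue sets\<close>

lemma locally_integrable_measurable: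
  assumes "locally_integrable f"
  shows "f \<in> borel_measurable lebesgue"
proof (rule borel_measurable_LIMSEQ_metric)
  show "(\<lambda>x. indicator (cball 0 (real n)) x *\<^sub>R f x) \<in> borel_measurable lebesgue" for n
    using assms unfolding locally_integrable_def set_integrable_def
    by (intro borel_measurable_integrable) simp
  fix x
  have "\<forall>\<^sub>F n in sequentially. indicator (cball 0 (real n)) x *\<^sub>R f x = f x"
    using eventually_ge_at_top[of "nat \<lceil>norm x\<rceil>"]
  proof eventually_elim
    case (elim n)
    then have "norm x \<le> real n" by linarith
    then show ?case by simp
  qed
  then show "(\<lambda>n. indicator (cball 0 (real n)) x *\<^sub>R f x) \<longlonglongrightarrow> f x"
    by (rule tendsto_eventually)
qed

text \<open>The bumps are bounded by 1, vanish outside one fixed box and tend pointwise to its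
  indicator, so dominated convergence applies.\<close>

lemma integral_box_eq_0:
  assumes f: "locally_integrable f"
    and 0: "\<And>\<phi>. test_function \<phi> \<Longrightarrow> (LINT x|lebesgue. f x * complex_of_real (\<phi> x)) = 0"
  shows "(LINT x|lebesgue. indicator (box a b) x *\<^sub>R f x) = 0"
proof -
  have [measurable]: "f \<in> borel_measurable lebesgue"
    by (rule locally_integrable_measurable[OF f])
  have "Ck 0 (box_bump a b s)" for s
    unfolding box_bump_def by (intro Ck_prod Ck_mult Ck_flat)
  then have "box_bump a b s \<in> borel_measurable lebesgue" for s
    by (intro borel_imp_lebesgue borel_measurable_continuous_onI) simp
  note [measurable] = this
  have "(\<lambda>n. LINT x|lebesgue. f x * complex_of_real (box_bump a b (real (Suc n)) x))
      \<longlonglongrightarrow> (LINT x|lebesgue. indicator (box a b) x *\<^sub>R f x)"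
  proof (rule integral_dominated_convergence)
    \<comment> \<open>Local integrability concerns compact sets, so the closed box supplies the
      majorant.\<close>
    show "integrable lebesgue (\<lambda>x. norm (indicator (cbox a b) x *\<^sub>R f x))"
      using f unfolding locally_integrable_def set_integrable_def by (intro integrable_norm) simp
    have "norm (f x * complex_of_real (box_bump a b (real (Suc n)) x))
        \<le> norm (indicator (cbox a b) x *\<^sub>R f x)" for n x
    proof (cases "x \<in> box a b")
      case True
      then have "x \<in> cbox a b" using box_subset_cbox by blast
      then show ?thesis using box_bump_bounds[of a b "real (Suc n)" x]
        by (simp add: norm_mult mult_left_le)
    qed (simp add: box_bump_outside)
    then show "AE x in lebesgue. norm (f x * complex_of_real (box_bump a b (real (Suc n)) x))
        \<le> norm (indicator (cbox a b) x *\<^sub>R f x)" for n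
      by simp
    have "(\<lambda>n. f x * complex_of_real (box_bump a b (real (Suc n)) x))
        \<longlonglongrightarrow> f x * complex_of_real (indicator (box a b) x)" for x
      by (intro tendsto_intros box_bump_tendsto)
    then show "AE x in lebesgue. (\<lambda>n. f x * complex_of_real (box_bump a b (real (Suc n)) x))
        \<longlonglongrightarrow> indicator (box a b) x *\<^sub>R f x"
      by (simp add: scaleR_conv_of_real mult.commute)
    have "box a b \<in> sets lebesgue" by simp
    then show "(\<lambda>x. indicator (box a b) x *\<^sub>R f x) \<in> borel_measurable lebesgue"
      by (intro borel_measurable_scaleR borel_measurable_indicator) simp_all
  qed simp_all
  moreover have "(LINT x|lebesgue. f x * complex_of_real (box_bump a b (real (Suc n)) x)) = 0" for n
    by (rule 0) (simp add: test_function_box_bump)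
  ultimately show ?thesis
    by (simp only: LIMSEQ_const_iff)
qed

text \<open>Open boxes are an intersection-stable generator of the Borel sets, so vanishing
  integrals spread from boxes to all Borel sets. The argument runs inside a bounded box, where
  \<open>f\<close> is integrable and complements are handled by subtraction; such boxes then exhaust
  the space.\<close>

lemma ae_zero_if_box_integrals_zero:
  fixes f :: "real^'n \<Rightarrow> complex"
  assumes f: "locally_integrable f"
    and 0: "\<And>a b. (LINT x|lebesgue. indicator (box a b) x *\<^sub>R f x) = 0"
  shows "ae_eq f (\<lambda>x. 0)"
proof -
  have [measurable]: "f \<in> borel_measurable lebesgue"
    by (rule locally_integrable_measurable[OF f])
  have "AE x in lebesgue. indicator (box (- vec (real m)) (vec (real m))) x *\<^sub>R f x = 0" for m :: nat
  proof (rule sigma_finite_measure.density_zero)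
    let ?B = "box (- vec (real m)) (vec (real m)) :: (real^'n) set"
    show "sigma_finite_measure (lebesgue :: (real^'n) measure)"
    proof
      obtain \<A> :: "(real^'n) set set" where \<A>: "countable \<A>" "\<A> \<subseteq> sets lborel" "\<Union>\<A> = space lborel"
        "\<forall>a\<in>\<A>. emeasure lborel a \<noteq> \<infinity>"
        using lborel.sigma_finite_countable by blast
      then show "\<exists>\<A>. countable \<A> \<and> \<A> \<subseteq> sets lebesgue \<and> \<Union>\<A> = space lebesgue \<and>
          (\<forall>a\<in>\<A>. emeasure (lebesgue :: (real^'n) measure) a \<noteq> \<infinity>)"
        by (intro exI[of _ \<A>]) (auto simp: subset_iff)
    qed
    let ?g = "\<lambda>x. indicator ?B x *\<^sub>R f x"
    have "integrable lebesgue (\<lambda>x. indicator ?B x *\<^sub>R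
        (indicator (cbox (- vec (real m)) (vec (real m))) x *\<^sub>R f x))"
      using f compact_cbox unfolding locally_integrable_def set_integrable_def
      by (intro integrable_mult_indicator[of ?B]) simp_all
    also have "(\<lambda>x. indicator ?B x *\<^sub>R
        (indicator (cbox (- vec (real m)) (vec (real m))) x *\<^sub>R f x)) = ?g"
      using box_subset_cbox by (fastforce simp: indicator_def)
    finally show int: "integrable lebesgue ?g" .
    have ind: "integrable lebesgue (\<lambda>x. indicator A x *\<^sub>R ?g x)" if "A \<in> sets lebesgue" for A
      using integrable_mult_indicator[OF that int] .
    have full: "(LINT x|lebesgue. ?g x) = 0" by (rule 0)
    have boxes: "A \<in> sets lebesgue" if "A \<in> sigma_sets UNIV (range (\<lambda>(a, b). box a b))"
      for A :: "(real^'n) set"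
    proof -
      have "A \<in> sets (sigma UNIV (range (\<lambda>(a, b). box a b)))" using that by simp
      then show ?thesis unfolding borel_eq_box[symmetric] by simp
    qed
    have borel: "(LINT x|lebesgue. indicator A x *\<^sub>R ?g x) = 0" if "A \<in> sets borel" for A
    proof -
      have *: "A \<in> sigma_sets UNIV (range (\<lambda>(a, b). box a b))"
        using that by (simp add: borel_eq_box)
      have "Int_stable (range (\<lambda>(a, b). box a b :: (real^'n) set))"
        by (auto simp: Int_stable_def box_Int_box)
      moreover have "range (\<lambda>(a, b). box a b) \<subseteq> Pow (UNIV :: (real^'n) set)" by simp
      ultimately show ?thesis using *
      proof (induction rule: sigma_sets_induct_disjoint)
        case (basic A)
        then obtain a b where "A = box a b" by auto
        \<comment> \<open>The cut-off to \<open>?B\<close> keeps boxes boxes, so the hypothesis also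
          covers truncated integrals.\<close>
        moreover have "\<exists>c d. box a b \<inter> ?B = box c d"
          unfolding box_Int_box by blast
        ultimately obtain c d where "A \<inter> ?B = box c d" by blast
        then show ?case using 0[of c d] by (simp flip: indicator_inter_arith)
      next
        case empty
        show ?case by simp
      next
        case (compl A)
        then have "A \<in> sets lebesgue" by (intro boxes)
        have "indicator (UNIV - A) x *\<^sub>R ?g x = ?g x - indicator A x *\<^sub>R ?g x" for x
          by (auto simp: indicator_def)
        then show ?case
          using ind[OF \<open>A \<in> sets lebesgue\<close>] int full compl by simp
      next
        case (union A)
        then have A: "A i \<in> sets lebesgue" for i by (intro boxes) blast
        have "(LINT x:(\<Union>i. A i)|lebesgue. ?g x) = (\<Sum>i. (LINT x:(A i)|lebesgue. ?g x))"
        proof (rule lebesgue_integral_countable_add)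
          show "set_integrable lebesgue (\<Union>i. A i) ?g"
            unfolding set_integrable_def using A by (intro ind) blast
        qed (use A union in \<open>auto simp: disjoint_family_on_def\<close>)
        then show ?case using union by (simp add: set_lebesgue_integral_def)
      qed
    qed
    fix A :: "(real^'n) set" assume "A \<in> sets lebesgue"
    \<comment> \<open>A Lebesgue set differs from its Borel main part by a null set, so its integral
      is one already known to vanish.\<close>
    then have A: "A \<in> sets lebesgue" "main_part lborel A \<in> sets borel"
      using main_part_sets[of A lborel] by simp_all
    have "AE x in lebesgue. x \<notin> null_part lborel A"
      using null_part[OF A(1)] by (intro AE_not_in) (auto simp: null_sets_completion_iff2)
    then have "AE x in lebesgue. indicator A x *\<^sub>R ?g x = indicator (main_part lborel A) x *\<^sub>R ?g x"
    proof eventually_elim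
      case (elim x)
      then show ?case using main_part_null_part_Un[OF A(1)] by (auto simp: indicator_def)
    qed
    then have "(LINT x|lebesgue. indicator A x *\<^sub>R ?g x) =
        (LINT x|lebesgue. indicator (main_part lborel A) x *\<^sub>R ?g x)"
      using A ind[THEN borel_measurable_integrable] by (intro integral_cong_AE) simp_all
    then show "(LINT x:A|lebesgue. ?g x) = 0"
      using borel[OF A(2)] by (simp add: set_lebesgue_integral_def)
  qed
  then have "AE x in lebesgue. \<forall>m::nat. indicator (box (- vec (real m)) (vec (real m))) x *\<^sub>R f x = 0"
    unfolding AE_all_countable by blast
  then show ?thesis
    unfolding ae_eq_def
  proof eventually_elim
    case (elim x)
    obtain m :: nat where "norm x < real m" using reals_Archimedean2 by blast
    then have "x \<in> box (- vec (real m)) (vec (real m))"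
      using component_le_norm_cart[of x] by (auto simp: mem_box_cart abs_less_iff) (smt (verit))+
    then show ?case using elim by (metis indicator_simps(1) scaleR_one)
  qed
qed

lemma locally_integrable_diff:
  "locally_integrable f \<Longrightarrow> locally_integrable h \<Longrightarrow> locally_integrable (\<lambda>x. f x - h x)"
  unfolding locally_integrable_def by (intro allI impI set_integral_diff(1)) simp_all


lemma integrable_times_compact_support:
  fixes f :: "real^'n \<Rightarrow> complex"
  assumes f: "locally_integrable f" and \<phi>: "continuous_on UNIV \<phi>"
    and K: "compact K" "\<And>x. x \<notin> K \<Longrightarrow> \<phi> x = 0"
  shows "integrable lebesgue (\<lambda>x. f x * complex_of_real (\<phi> x))"
proof -
  have [measurable]: "f \<in> borel_measurable lebesgue"
    by (rule locally_integrable_measurable[OF f])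
  have [measurable]: "\<phi> \<in> borel_measurable lebesgue"
    using \<phi> by (intro borel_imp_lebesgue borel_measurable_continuous_onI)
  have "bounded (\<phi> ` K)"
    by (rule compact_imp_bounded[OF compact_continuous_image[OF continuous_on_subset[OF \<phi>] K(1)]]) simp
  then obtain B where B: "\<bar>\<phi> x\<bar> \<le> B" if "x \<in> K" for x
    by (auto simp: bounded_iff)
  show ?thesis
  proof (rule Bochner_Integration.integrable_bound)
    show "integrable lebesgue (\<lambda>x. B *\<^sub>R (indicator K x *\<^sub>R f x))"
      using f K(1) unfolding locally_integrable_def set_integrable_def
      by (intro integrable_scaleR_right) blast
    have "norm (f x * complex_of_real (\<phi> x)) \<le> norm (B *\<^sub>R (indicator K x *\<^sub>R f x))" for x
    proof (cases "x \<in> K")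
      case True
      then have "\<bar>\<phi> x\<bar> * cmod (f x) \<le> \<bar>B\<bar> * cmod (f x)"
        using B[of x] by (intro mult_right_mono) auto
      then show ?thesis using True by (simp add: norm_mult mult.commute[of "cmod (f x)"])
    qed (simp add: K)
    then show "AE x in lebesgue. norm (f x * complex_of_real (\<phi> x)) \<le> norm (B *\<^sub>R (indicator K x *\<^sub>R f x))"
      by simp
  qed simp
qed

lemma test_function_continuous: "test_function \<phi> \<Longrightarrow> continuous_on UNIV \<phi>"
  by (metis Ck.simps(1) test_function_def)

lemma test_function_partial_continuous:
  assumes "test_function \<phi>"
  shows "continuous_on UNIV (partial i \<phi>)"
proof -
  have "Ck (Suc 0) \<phi>" using assms unfolding test_function_def by blast
  then show ?thesis by simp
qed

lemma eq_0_outside_support: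
  assumes "x \<notin> closure {x. \<phi> x \<noteq> 0}"
  shows "\<phi> x = 0"
proof (rule ccontr)
  assume "\<phi> x \<noteq> 0"
  then have "x \<in> {x. \<phi> x \<noteq> 0}" by simp
  then have "x \<in> closure {x. \<phi> x \<noteq> 0}" by (rule subsetD[OF closure_subset])
  with assms show False by contradiction
qed

text \<open>Outside the closed support \<open>\<phi>\<close> vanishes on a whole neighbourhood and
  not merely at the point, so its derivative is that of 0.\<close>

lemma partial_eq_0:
  assumes "x \<notin> closure {x. \<phi> x \<noteq> 0}"
  shows "partial i \<phi> x = 0"
proof -
  have "(\<phi> has_derivative (\<lambda>v. 0)) (at x)"
  proof (rule has_derivative_transform_within_open[where s = "- closure {x. \<phi> x \<noteq> 0}"])
    show "((\<lambda>x. 0) has_derivative (\<lambda>v. 0)) (at x)" by simp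
    show "open (- closure {x. \<phi> x \<noteq> 0})" by (intro open_Compl closed_closure)
    show "x \<in> - closure {x. \<phi> x \<noteq> 0}" using assms by simp
    show "0 = \<phi> y" if "y \<in> - closure {x. \<phi> x \<noteq> 0}" for y
      using eq_0_outside_support[of y \<phi>] that by simp
  qed
  then show ?thesis by (rule partial_eqI)
qed

text \<open>Integrals of non-integrable functions are 0 by default, so the identities in
  \<open>has_dist_grad\<close> can be added and subtracted only once these products are known to be
  integrable.\<close>

lemma integrable_times_test_function:
  assumes "locally_integrable f" "test_function \<phi>"
  shows "integrable lebesgue (\<lambda>x. f x * complex_of_real (\<phi> x))"
    and "integrable lebesgue (\<lambda>x. f x * complex_of_real (partial i \<phi> x))"
proof -
  have K: "compact (closure {x. \<phi> x \<noteq> 0})" using assms(2) by (simp add: test_function_def)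
  show "integrable lebesgue (\<lambda>x. f x * complex_of_real (\<phi> x))"
    by (rule integrable_times_compact_support[OF assms(1) test_function_continuous[OF assms(2)] K])
       (rule eq_0_outside_support)
  show "integrable lebesgue (\<lambda>x. f x * complex_of_real (partial i \<phi> x))"
    by (rule integrable_times_compact_support[OF assms(1) test_function_partial_continuous[OF assms(2)] K])
       (rule partial_eq_0)
qed

text \<open>Each component of the difference integrates to 0 against all test functions, so the
  fundamental lemma applies. This is what makes statements about the chosen \<open>dist_grad\<close>
  possible.\<close>

lemma has_dist_grad_unique:
  assumes "has_dist_grad g G" "has_dist_grad g G'"
  shows "AE x in lebesgue. G x = G' x"
proof -
  have "ae_eq (\<lambda>x. G x $ i) (\<lambda>x. G' x $ i)" for i
  proof -
    have loc: "locally_integrable (\<lambda>x. G x $ i)" "locally_integrable (\<lambda>x. G' x $ i)"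
      using assms by (auto simp: has_dist_grad_def)
    have "(LINT x|lebesgue. (G x $ i - G' x $ i) * complex_of_real (\<phi> x)) = 0"
      if \<phi>: "test_function \<phi>" for \<phi>
    proof -
      note int = loc[THEN integrable_times_test_function(1), OF \<phi>]
      have "(LINT x|lebesgue. G x $ i * complex_of_real (\<phi> x))
          = (LINT x|lebesgue. G' x $ i * complex_of_real (\<phi> x))"
      proof -
        have "- (LINT x|lebesgue. G x $ i * complex_of_real (\<phi> x))
            = - (LINT x|lebesgue. G' x $ i * complex_of_real (\<phi> x))"
          using assms[unfolded has_dist_grad_def, THEN conjunct2, THEN conjunct2, THEN spec[of _ \<phi>],
              THEN spec[of _ i], rule_format, OF \<phi>] by argo
        then show ?thesis by simp
      qed
      then show ?thesis
        using int \<phi>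
        by (simp add: left_diff_distrib test_function_def)
    qed
    then have "ae_eq (\<lambda>x. G x $ i - G' x $ i) (\<lambda>x. 0)"
      using loc by (intro ae_zero_if_box_integrals_zero integral_box_eq_0 locally_integrable_diff) auto
    then show ?thesis by (simp add: ae_eq_def)
  qed
  then have "AE x in lebesgue. \<forall>i. G x $ i = G' x $ i"
    unfolding ae_eq_def by (subst AE_all_countable) auto
  then show ?thesis by eventually_elim (simp add: vec_eq_iff)
qed

section \<open>Spectral families of form operators\<close>

lemma continuous_at_right_min:
  fixes F :: "real \<Rightarrow> real"
  assumes "continuous (at_right a) F"
  shows "continuous (at_right a) (\<lambda>t. F (min t m))"
proof (cases "a < m")
  case True
  have "\<forall>\<^sub>F t in at_right a. F t = F (min t m)"
    using eventually_at_right_real[OF True] by eventually_elim (simp add: min_def)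
  then have "((\<lambda>t. F (min t m)) \<longlongrightarrow> F a) (at_right a)"
    using assms unfolding continuous_within by (rule Lim_transform_eventually[rotated])
  then show ?thesis using True by (simp add: continuous_within min_def)
next
  case False
  have "\<forall>\<^sub>F t in at_right a. F m = F (min t m)"
    using eventually_at_right_less[of a] False by (auto elim!: eventually_mono simp: min_def)
  then have "((\<lambda>t. F (min t m)) \<longlongrightarrow> F m) (at_right a)"
    by (rule Lim_transform_eventually[rotated]) simp
  then show ?thesis using False by (simp add: continuous_within min_absorb2)
qed

text \<open>Stopping \<open>F\<close> at \<open>m\<close> and subtracting \<open>F\<close> stopped
  at \<open>n\<close> leaves exactly its growth on \<open>{n<..m}\<close>. It suffices to compare
  the measures on half-open intervals, which are intersection-stable and generate the Borel
  sets.\<close>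

lemma interval_measure_restrict:
  fixes F :: "real \<Rightarrow> real"
  assumes mono: "\<And>x y. x \<le> y \<Longrightarrow> F x \<le> F y"
    and rc: "\<And>a. continuous (at_right a) F" and "n \<le> m"
  shows "interval_measure (\<lambda>t. F (min t m) - F (min t n)) =
    density (interval_measure F) (\<lambda>s. ennreal (indicator {n<..m} s))" (is "?M = ?N")
proof -
  let ?G = "\<lambda>t. F (min t m) - F (min t n)"
  have G_mono: "?G x \<le> ?G y" if "x \<le> y" for x y
    using that \<open>n \<le> m\<close> mono[of n y] mono[of x y] mono[of x m] mono[of n m] mono[of y m]
    by (auto simp: min_def)
  have G_rc: "continuous (at_right a) ?G" for a
    by (intro continuous_diff continuous_at_right_min rc)
  have N: "emeasure ?N {c<..d} = emeasure ?M {c<..d}" if "c \<le> d" for c d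
  proof -
    have "emeasure ?N {c<..d} = (\<integral>\<^sup>+s. indicator ({n<..m} \<inter> {c<..d}) s \<partial>interval_measure F)"
    proof (subst emeasure_density)
      show "(\<integral>\<^sup>+s. ennreal (indicator {n<..m} s) * indicator {c<..d} s \<partial>interval_measure F) =
          (\<integral>\<^sup>+s. indicator ({n<..m} \<inter> {c<..d}) s \<partial>interval_measure F)"
        by (intro nn_integral_cong) (simp add: indicator_def)
    qed simp_all
    also have "{n<..m} \<inter> {c<..d} = {max n c<..min m d}" by auto
    also have "(\<integral>\<^sup>+s. indicator {max n c<..min m d} s \<partial>interval_measure F) =
        emeasure (interval_measure F) {max n c<..min m d}"
      by simp
    \<comment> \<open>The intersection may be empty; the default 0 then agrees with
      \<open>?G d - ?G c\<close>, as \<open>?G\<close> is constant on either side of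
      \<open>{n<..m}\<close>.\<close>
    also have "\<dots> = (if max n c \<le> min m d then F (min m d) - F (max n c) else 0)"
      by (rule emeasure_interval_measure_Ioc_eq[OF mono rc])
    also have "(if max n c \<le> min m d then F (min m d) - F (max n c) else 0) = ?G d - ?G c"
      using that \<open>n \<le> m\<close> by (auto simp: min_def max_def)
    also have "ennreal (?G d - ?G c) = emeasure ?M {c<..d}"
      using that by (simp only: emeasure_interval_measure_Ioc_eq[OF G_mono G_rc] if_True)
    finally show ?thesis .
  qed
  show ?thesis
  proof (rule measure_eqI_generator_eq)
    let ?E = "range (\<lambda>(a, b). {a<..b::real})"
    show "Int_stable ?E"
      by (auto simp: Int_stable_def)
    show "?E \<subseteq> Pow UNIV" by simp
    show "emeasure ?M X = emeasure ?N X" if "X \<in> ?E" for X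
    proof -
      obtain c d where X: "X = {c<..d}" using \<open>X \<in> ?E\<close> by auto
      show ?thesis
      proof (cases "c \<le> d")
        case True
        then show ?thesis using N X by simp
      qed (simp add: X)
    qed
    show "sets ?M = sigma_sets UNIV ?E" "sets ?N = sigma_sets UNIV ?E"
      by (simp_all add: borel_sigma_sets_Ioc)
    show "range (\<lambda>i::nat. {- real i<..real i}) \<subseteq> ?E" by auto
    show "(\<Union>i::nat. {- real i<..real i}) = UNIV"
    proof -
      have "x \<in> (\<Union>i::nat. {- real i<..real i})" for x
      proof -
        obtain i :: nat where "\<bar>x\<bar> < real i" using reals_Archimedean2 by blast
        then have "x \<in> {- real i<..real i}" by auto
        then show ?thesis by blast
      qed
      then show ?thesis by blast
    qed
    show "emeasure ?M {- real i<..real i} \<noteq> \<infinity>" for i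
      by (simp add: emeasure_interval_measure_Ioc_eq[OF G_mono G_rc])
  qed
qed

text \<open>What min-max needs of a form, separated from gradients. Membership of the sum is a
  premise of \<open>q_add\<close>, so closure of \<open>Q\<close> is asked for differences only;
  each sum formed below is already known to lie in \<open>Q\<close>.\<close>

locale form_spectral_family =
  fixes Q :: "(real^'n \<Rightarrow> complex) set"
    and q :: "(real^'n \<Rightarrow> complex) \<Rightarrow> (real^'n \<Rightarrow> complex) \<Rightarrow> complex"
    and P :: "real \<Rightarrow> (real^'n \<Rightarrow> complex) \<Rightarrow> (real^'n \<Rightarrow> complex)"
  assumes Q_L2: "Q \<subseteq> L2"
    and Q_diff: "\<And>f h. f \<in> Q \<Longrightarrow> h \<in> Q \<Longrightarrow> (\<lambda>x. f x - h x) \<in> Q"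
    and q_add: "\<And>f h. f \<in> Q \<Longrightarrow> h \<in> Q \<Longrightarrow> (\<lambda>x. f x + h x) \<in> Q \<Longrightarrow>
      Re (q (\<lambda>x. f x + h x) (\<lambda>x. f x + h x)) = Re (q f f) + Re (q h h) + 2 * Re (q f h)"
    and bounded_below: "bounded_below_form Q q"
    and spectral_family: "spectral_family (form_operator Q q) P"
begin

section \<open>Algebra of the spectral projections\<close>

lemma P_L2: "f \<in> L2 \<Longrightarrow> P t f \<in> L2"
  using spectral_family by (auto simp: spectral_family_def orth_projection_def)

lemma P_sym: "f \<in> L2 \<Longrightarrow> h \<in> L2 \<Longrightarrow> ip (P t f) h = ip f (P t h)"
  using spectral_family by (auto simp: spectral_family_def orth_projection_def)

lemma P_absorb: "s \<le> t \<Longrightarrow> f \<in> L2 \<Longrightarrow> ae_eq (P s (P t f)) (P s f)"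
  using spectral_family by (auto simp: spectral_family_def)

lemma P_cong:
  assumes "ae_eq f f'" "f \<in> L2" "f' \<in> L2"
  shows "ae_eq (P t f) (P t f')"
proof (rule ae_eqI_ip)
  fix k :: "real^'n \<Rightarrow> complex" assume "k \<in> L2"
  then show "ip (P t f) k = ip (P t f') k"
    using assms ip_cong[OF assms(1) ae_eq_refl, of "P t k"] by (simp add: P_L2 P_sym)
qed (use assms in \<open>auto simp: P_L2\<close>)

lemma P_add:
  assumes "f \<in> L2" "h \<in> L2"
  shows "ae_eq (P t (\<lambda>x. f x + h x)) (\<lambda>x. P t f x + P t h x)"
  using assms by (intro ae_eqI_ip) (auto simp: P_L2 P_sym L2_add ip_add_left)

lemma P_diff:
  assumes "f \<in> L2" "h \<in> L2"
  shows "ae_eq (P t (\<lambda>x. f x - h x)) (\<lambda>x. P t f x - P t h x)"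
  using assms by (intro ae_eqI_ip) (auto simp: P_L2 P_sym L2_diff ip_diff_left)

lemma P_cmult:
  assumes "f \<in> L2"
  shows "ae_eq (P t (\<lambda>x. c * f x)) (\<lambda>x. c * P t f x)"
  using assms by (intro ae_eqI_ip) (auto simp: P_L2 P_sym L2_cmult ip_cmult_left)

lemma P_sum:
  assumes "\<And>i. i \<in> I \<Longrightarrow> v i \<in> L2"
  shows "ae_eq (P t (\<lambda>x. \<Sum>i\<in>I. c i * v i x)) (\<lambda>x. \<Sum>i\<in>I. c i * P t (v i) x)"
  using assms
proof (induction I rule: infinite_finite_induct)
  case (insert i I)
  have "ae_eq (P t (\<lambda>x. c i * v i x + (\<Sum>i\<in>I. c i * v i x)))
      (\<lambda>x. P t (\<lambda>x. c i * v i x) x + P t (\<lambda>x. \<Sum>i\<in>I. c i * v i x) x)"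
    using insert.prems by (intro P_add L2_cmult L2_sum) auto
  also have "ae_eq \<dots> (\<lambda>x. c i * P t (v i) x + (\<Sum>i\<in>I. c i * P t (v i) x))"
    using insert by (intro ae_eq_add P_cmult) auto
  finally show ?case using insert.hyps by simp
qed (use P_cmult[OF L2_zero, of t 0] in simp_all)

text \<open>The adjoint of \<open>P_absorb\<close>. Together they say that a composition of two
  projections, in either order, is the one with the smaller parameter.\<close>

lemma P_absorb':
  assumes "s \<le> t" "f \<in> L2"
  shows "ae_eq (P t (P s f)) (P s f)"
proof (rule ae_eqI_ip)
  fix k :: "real^'n \<Rightarrow> complex" assume k: "k \<in> L2"
  have "ip (P t (P s f)) k = ip f (P s (P t k))"
    using assms k by (simp add: P_L2 P_sym)
  also have "\<dots> = ip f (P s k)"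
    using assms k by (intro ip_cong P_absorb ae_eq_refl) (auto simp: P_L2)
  finally show "ip (P t (P s f)) k = ip (P s f) k"
    using assms k by (simp add: P_sym)
qed (use assms in \<open>auto simp: P_L2\<close>)

lemma P_min:
  assumes "f \<in> L2"
  shows "ae_eq (P t (P m f)) (P (min t m) f)"
  using P_absorb[OF _ assms, of t m] P_absorb'[OF _ assms, of m t] by (cases "t \<le> m") (auto simp: min_def)

lemma ip_P_P:
  assumes "s \<le> t" "f \<in> L2"
  shows "ip (P t f) (P s f) = ip (P s f) (P s f)"
proof -
  have "ip (P t f) (P s f) = ip f (P t (P s f))"
    using assms by (simp add: P_sym P_L2)
  also have "\<dots> = ip f (P s (P s f))"
    using assms ae_eq_trans[OF P_absorb'[OF assms] ae_eq_sym[OF P_absorb'[OF order_refl assms(2)]]]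
    by (intro ip_cong ae_eq_refl) (simp_all add: P_L2)
  finally show ?thesis using assms by (simp add: P_sym P_L2)
qed

text \<open>Pythagoras: by \<open>ip_P_P\<close> the increment is orthogonal to
  \<open>P s f\<close>.\<close>

lemma L2norm_P_diff:
  assumes "s \<le> t" "f \<in> L2"
  shows "(L2norm (\<lambda>x. P t f x - P s f x))\<^sup>2 = (L2norm (P t f))\<^sup>2 - (L2norm (P s f))\<^sup>2"
proof -
  have "ip (P s f) (P t f) = ip (P s f) (P s f)"
    using arg_cong[OF ip_P_P[OF assms], of cnj] by (simp add: ip_cnj)
  then have "ip (\<lambda>x. P t f x - P s f x) (\<lambda>x. P t f x - P s f x) = ip (P t f) (P t f) - ip (P s f) (P s f)"
    using assms ip_P_P[OF assms] by (simp add: P_L2 L2_diff ip_diff_left ip_diff_right)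
  then show ?thesis unfolding ip_self of_real_diff[symmetric] of_real_eq_iff .
qed

section \<open>Spectral measures and form values of slices\<close>

lemma L2norm_P_mono:
  assumes "f \<in> L2" "s \<le> t"
  shows "(L2norm (P s f))\<^sup>2 \<le> (L2norm (P t f))\<^sup>2"
  using L2norm_P_diff[OF assms(2,1)] zero_le_power2[of "L2norm (\<lambda>x. P t f x - P s f x)"] by linarith

lemma L2norm_P_right_continuous:
  assumes "f \<in> L2"
  shows "continuous (at_right s) (\<lambda>t. (L2norm (P t f))\<^sup>2)"
proof -
  have "((\<lambda>t. L2norm (\<lambda>x. P t f x - P s f x)) \<longlongrightarrow> 0) (at_right s)"
    using spectral_family assms by (simp add: spectral_family_def)
  then have "((\<lambda>t. L2norm (P t f)) \<longlongrightarrow> L2norm (P s f)) (at_right s)"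
    by (intro L2norm_tendsto) (auto simp: P_L2 assms)
  then show ?thesis unfolding continuous_within by (intro tendsto_power)
qed

text \<open>Projecting a slice at level \<open>t\<close> gives the increment of \<open>P\<close>
  between \<open>min t n\<close> and \<open>min t m\<close>, so by Pythagoras its distribution
  function grows as that of \<open>f\<close> on \<open>{n<..m}\<close> and nowhere else.\<close>

lemma spectral_measure_slice:
  assumes f: "f \<in> L2" and "\<psi> \<in> L2" "n \<le> m" and \<psi>: "ae_eq \<psi> (\<lambda>x. P m f x - P n f x)"
  shows "spectral_measure_at P \<psi> =
    density (spectral_measure_at P f) (\<lambda>s. ennreal (indicator {n<..m} s))"
proof -
  have "(L2norm (P t \<psi>))\<^sup>2 = (L2norm (P (min t m) f))\<^sup>2 - (L2norm (P (min t n) f))\<^sup>2" for t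
  proof -
    have "ae_eq (P t \<psi>) (P t (\<lambda>x. P m f x - P n f x))"
      using assms by (intro P_cong) (auto simp: P_L2 L2_diff)
    also have "ae_eq \<dots> (\<lambda>x. P t (P m f) x - P t (P n f) x)"
      using assms by (intro P_diff) (auto simp: P_L2)
    also have "ae_eq \<dots> (\<lambda>x. P (min t m) f x - P (min t n) f x)"
      using assms by (intro ae_eq_diff P_min)
    finally have "L2norm (P t \<psi>) = L2norm (\<lambda>x. P (min t m) f x - P (min t n) f x)"
      using assms by (intro L2norm_cong) (auto simp: P_L2 L2_diff)
    then show ?thesis using \<open>n \<le> m\<close> f by (simp add: L2norm_P_diff min.coboundedI1)
  qed
  then show ?thesis
    unfolding spectral_measure_at_def
    using interval_measure_restrict[OF L2norm_P_mono[OF f] L2norm_P_right_continuous[OF f] \<open>n \<le> m\<close>]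
    by simp
qed

lemma measure_spectral_Ioc:
  assumes "f \<in> L2" "n \<le> m"
  shows "emeasure (spectral_measure_at P f) {n<..m} = ennreal ((L2norm (\<lambda>x. P m f x - P n f x))\<^sup>2)"
  unfolding spectral_measure_at_def
  using emeasure_interval_measure_Ioc[OF assms(2) L2norm_P_mono[OF assms(1)] L2norm_P_right_continuous[OF assms(1)]]
  by (simp add: L2norm_P_diff assms)

lemma integrable_spectral_slice:
  fixes k :: "real \<Rightarrow> real"
  assumes "f \<in> L2" "n \<le> m" "continuous_on UNIV k"
  shows "integrable (spectral_measure_at P f) (\<lambda>s. indicator {n<..m} s *\<^sub>R k s)"
proof -
  have "bounded (k ` {n..m})"
    by (intro compact_imp_bounded compact_continuous_image continuous_on_subset[OF assms(3)]) auto
  then obtain B where "\<And>s. s \<in> {n..m} \<Longrightarrow> \<bar>k s\<bar> \<le> B"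
    unfolding bounded_iff by fastforce
  then have "AE s in spectral_measure_at P f. s \<in> {n<..m} \<longrightarrow> norm (k s) \<le> B" by auto
  moreover have "k \<in> borel_measurable (spectral_measure_at P f)"
    using borel_measurable_continuous_onI[OF assms(3)] unfolding spectral_measure_at_def
    by (simp cong: measurable_cong_sets)
  ultimately show ?thesis
    using measure_spectral_Ioc[OF assms(1,2)]
    by (intro integrableI_bounded_set_indicator) (auto simp: spectral_measure_at_def)
qed

lemma slice_form:
  assumes f: "f \<in> L2" and "\<psi> \<in> L2" "n \<le> m" and \<psi>: "ae_eq \<psi> (\<lambda>x. P m f x - P n f x)"
  shows slice_domain: "\<exists>h. (\<psi>, h) \<in> form_operator Q q"
    and slice_in_Q: "\<psi> \<in> Q"
    and slice_integral: "Re (q \<psi> \<psi>) = (LINT s|spectral_measure_at P f. indicator {n<..m} s *\<^sub>R s)"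
proof -
  note slice = spectral_measure_slice[OF assms]
  have ms: "k \<in> borel_measurable (spectral_measure_at P f)" if "k \<in> borel_measurable borel"
    for k :: "real \<Rightarrow> real"
    using that unfolding spectral_measure_at_def by (simp cong: measurable_cong_sets)
  have "integrable (spectral_measure_at P \<psi>) (\<lambda>t. t\<^sup>2)"
    unfolding slice
    by (subst integrable_density)
       (use integrable_spectral_slice[OF f \<open>n \<le> m\<close> continuous_on_power[OF continuous_on_id, of _ 2]] in
         \<open>auto intro!: ms\<close>)
  then have "\<psi> \<in> Domain (form_operator Q q)"
    using spectral_family \<open>\<psi> \<in> L2\<close> by (simp add: spectral_family_def)
  then obtain h where h: "(\<psi>, h) \<in> form_operator Q q" by blast
  then show "\<exists>h. (\<psi>, h) \<in> form_operator Q q" by blast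
  show "\<psi> \<in> Q" using h by (simp add: form_operator_def)
  have "q \<psi> \<psi> = ip \<psi> h" using h by (simp add: form_operator_def)
  also have "\<dots> = complex_of_real (LINT t|spectral_measure_at P \<psi>. t)"
    using h spectral_family by (auto simp: spectral_family_def)
  finally show "Re (q \<psi> \<psi>) = (LINT s|spectral_measure_at P f. indicator {n<..m} s *\<^sub>R s)"
    unfolding slice by (subst (asm) integral_density) (auto intro!: ms)
qed

lemma slice_bounds:
  assumes f: "f \<in> L2" and "\<psi> \<in> L2" "n \<le> m" and \<psi>: "ae_eq \<psi> (\<lambda>x. P m f x - P n f x)"
  shows slice_lower: "n * (L2norm \<psi>)\<^sup>2 \<le> Re (q \<psi> \<psi>)"
    and slice_upper: "Re (q \<psi> \<psi>) \<le> m * (L2norm \<psi>)\<^sup>2"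
proof -
  let ?\<mu> = "spectral_measure_at P f"
  have "L2norm \<psi> = L2norm (\<lambda>x. P m f x - P n f x)"
    using assms by (intro L2norm_cong) (auto simp: P_L2 L2_diff)
  then have "measure ?\<mu> {n<..m} = (L2norm \<psi>)\<^sup>2"
    using measure_spectral_Ioc[OF f \<open>n \<le> m\<close>] by (simp add: measure_def)
  then have const: "(LINT s|?\<mu>. indicator {n<..m} s *\<^sub>R c) = c * (L2norm \<psi>)\<^sup>2" for c :: real
    by (simp add: spectral_measure_at_def)
  have "(LINT s|?\<mu>. indicator {n<..m} s *\<^sub>R n) \<le> (LINT s|?\<mu>. indicator {n<..m} s *\<^sub>R s)"
    by (intro integral_mono integrable_spectral_slice f \<open>n \<le> m\<close> continuous_intros)
       (auto simp: indicator_def)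
  then show "n * (L2norm \<psi>)\<^sup>2 \<le> Re (q \<psi> \<psi>)"
    by (simp only: const slice_integral[OF assms])
  have "(LINT s|?\<mu>. indicator {n<..m} s *\<^sub>R s) \<le> (LINT s|?\<mu>. indicator {n<..m} s *\<^sub>R m)"
    by (intro integral_mono integrable_spectral_slice f \<open>n \<le> m\<close> continuous_intros)
       (auto simp: indicator_def)
  then show "Re (q \<psi> \<psi>) \<le> m * (L2norm \<psi>)\<^sup>2"
    by (simp only: const slice_integral[OF assms])
qed

text \<open>Form values of slices are integrals of \<open>s\<close>, which add over adjacent
  intervals. Against the quadratic expansion of the form this will force the cross term to
  vanish.\<close>

lemma slice_add:
  assumes f: "f \<in> L2" and "a \<le> n" "n \<le> m"
  shows "Re (q (\<lambda>x. P m f x - P a f x) (\<lambda>x. P m f x - P a f x)) =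
    Re (q (\<lambda>x. P m f x - P n f x) (\<lambda>x. P m f x - P n f x)) +
    Re (q (\<lambda>x. P n f x - P a f x) (\<lambda>x. P n f x - P a f x))"
proof -
  let ?\<mu> = "spectral_measure_at P f"
  have am: "a \<le> m" using assms by simp
  have L2: "(\<lambda>x. P t f x - P s f x) \<in> L2" for s t
    using f by (simp add: P_L2 L2_diff)
  have "(LINT s|?\<mu>. indicator {a<..m} s *\<^sub>R s) =
      (LINT s|?\<mu>. indicator {n<..m} s *\<^sub>R s + indicator {a<..n} s *\<^sub>R s)"
    using assms by (intro Bochner_Integration.integral_cong) (auto simp: indicator_def)
  also have "\<dots> = (LINT s|?\<mu>. indicator {n<..m} s *\<^sub>R s) + (LINT s|?\<mu>. indicator {a<..n} s *\<^sub>R s)"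
    by (intro Bochner_Integration.integral_add integrable_spectral_slice assms continuous_on_id)
  finally show ?thesis
    unfolding slice_integral[OF f L2 am ae_eq_refl] slice_integral[OF f L2 \<open>n \<le> m\<close> ae_eq_refl]
      slice_integral[OF f L2 \<open>a \<le> n\<close> ae_eq_refl] .
qed

text \<open>There is no spectrum below a lower bound of the form: a slice ending at
  \<open>t < c\<close> has form value at most \<open>t\<close> and at least \<open>c\<close> times
  its squared norm, so it is null. Hence the norm of \<open>P s f\<close> is constant for
  \<open>s \<le> t\<close>, and its limit at minus infinity is 0.\<close>

lemma P_eventually_0:
  assumes c: "\<And>f. f \<in> Q \<Longrightarrow> c * (L2norm f)\<^sup>2 \<le> Re (q f f)" and "t < c" and f: "f \<in> L2"
  shows "ae_eq (P t f) (\<lambda>x. 0)"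
proof -
  have "L2norm (P s f) = L2norm (P t f)" if "s < t" for s
  proof -
    let ?\<psi> = "\<lambda>x. P t f x - P s f x"
    have \<psi>: "?\<psi> \<in> L2" using f by (simp add: P_L2 L2_diff)
    have "s \<le> t" using that by simp
    have "c * (L2norm ?\<psi>)\<^sup>2 \<le> t * (L2norm ?\<psi>)\<^sup>2"
      using c[OF slice_in_Q[OF f \<psi> \<open>s \<le> t\<close> ae_eq_refl]] slice_upper[OF f \<psi> \<open>s \<le> t\<close> ae_eq_refl] by linarith
    then have "(L2norm ?\<psi>)\<^sup>2 = 0"
    proof -
      have "(c - t) * (L2norm ?\<psi>)\<^sup>2 \<le> 0"
        using \<open>c * (L2norm ?\<psi>)\<^sup>2 \<le> t * (L2norm ?\<psi>)\<^sup>2\<close> by (simp add: left_diff_distrib)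
      then show ?thesis
        using \<open>t < c\<close> zero_le_power2[of "L2norm ?\<psi>"] by (auto simp: mult_le_0_iff)
    qed
    then show ?thesis
      using L2norm_P_diff[OF \<open>s \<le> t\<close> f] by simp
  qed
  then have "\<forall>\<^sub>F s in at_bot. L2norm (P s f) = L2norm (P t f)"
    unfolding eventually_at_bot_dense by blast
  moreover have "((\<lambda>s. L2norm (P s f)) \<longlongrightarrow> 0) at_bot"
    using spectral_family f by (simp add: spectral_family_def)
  ultimately have "((\<lambda>s. L2norm (P t f)) \<longlongrightarrow> 0) (at_bot :: real filter)"
    by (simp add: tendsto_cong)
  then have "L2norm (P t f) = 0" by (simp add: tendsto_const_iff)
  then show ?thesis using L2norm_eq_0_iff P_L2 f by blast
qed

lemma lower_bound:
  obtains c where "\<And>f. f \<in> Q \<Longrightarrow> c * (L2norm f)\<^sup>2 \<le> Re (q f f)"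
  using bounded_below unfolding bounded_below_form_def by auto

lemma form_upper_on_range:
  assumes f: "f \<in> L2" and "ae_eq (P l f) f"
  shows "f \<in> Q" "Re (q f f) \<le> l * (L2norm f)\<^sup>2"
proof -
  obtain c where c: "\<And>f. f \<in> Q \<Longrightarrow> c * (L2norm f)\<^sup>2 \<le> Re (q f f)"
    using lower_bound by blast
  \<comment> \<open>Strictly below the lower bound, where the projection vanishes, and at most
    \<open>l\<close>: this turns \<open>f\<close> into a slice over \<open>{a<..l}\<close>.\<close>
  define a where "a = min (c - 1) l"
  have "ae_eq (P a f) (\<lambda>x. 0)" using c f by (intro P_eventually_0[of c]) (auto simp: a_def)
  then have *: "ae_eq f (\<lambda>x. P l f x - P a f x)"
    using ae_eq_diff[OF assms(2)] ae_eq_sym by fastforce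
  have "a \<le> l" by (simp add: a_def)
  then show "f \<in> Q" "Re (q f f) \<le> l * (L2norm f)\<^sup>2"
    using slice_in_Q[OF f f _ *] slice_upper[OF f f _ *] by auto
qed

text \<open>A spectral family only constrains the form on the operator domain. A general \<open>f \<in> Q\<close> is
  split into its spectral truncation and a remainder; the two are orthogonal for the form.\<close>

lemma form_lower_on_kernel:
  assumes f: "f \<in> Q" and l: "ae_eq (P l f) (\<lambda>x. 0)"
  shows "l * (L2norm f)\<^sup>2 \<le> Re (q f f)"
proof -
  have fL2: "f \<in> L2" using f Q_L2 by blast
  obtain c where c: "\<And>f. f \<in> Q \<Longrightarrow> c * (L2norm f)\<^sup>2 \<le> Re (q f f)"
    using lower_bound by blast
  define a where "a = min (c - 1) l"
  have a: "ae_eq (P a f) (\<lambda>x. 0)" using c fL2 by (intro P_eventually_0[of c]) (auto simp: a_def)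
  define F where "F n = (\<lambda>x. P n f x - P a f x)" for n
  have FL2: "F n \<in> L2" for n unfolding F_def by (intro L2_diff P_L2 fL2)
  have F_ae: "ae_eq (F n) (P n f)" for n
    unfolding F_def using ae_eq_diff[OF ae_eq_refl a] by simp
  have lim: "((\<lambda>n. L2norm (\<lambda>x. P n f x - f x)) \<longlongrightarrow> 0) at_top"
    using spectral_family fL2 by (simp add: spectral_family_def)
  have F_norm: "L2norm (\<lambda>x. F n x - f x) = L2norm (\<lambda>x. P n f x - f x)" for n
    by (intro L2norm_cong ae_eq_diff F_ae ae_eq_refl L2_diff FL2 P_L2 fL2)
  \<comment> \<open>The form of the remainder is bounded only through \<open>c\<close>, which may be
    very negative, but its squared norm tends to 0 as \<open>n\<close> grows.\<close>
  have bound: "c * (L2norm (\<lambda>x. F n x - f x))\<^sup>2 + l * (L2norm (F n))\<^sup>2 \<le> Re (q f f)" if "l \<le> n" for n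
  proof -
    have "a \<le> n" using that by (simp add: a_def)
    have "\<exists>h. (F n, h) \<in> form_operator Q q"
      by (rule slice_domain[OF fL2 FL2 \<open>a \<le> n\<close>]) (simp add: F_def)
    then obtain h where h: "(F n, h) \<in> form_operator Q q" by blast
    then have hL2: "h \<in> L2" and FQ: "F n \<in> Q" and qh: "\<And>\<phi>. \<phi> \<in> Q \<Longrightarrow> q \<phi> (F n) = ip \<phi> h"
      by (auto simp: form_operator_def)
    \<comment> \<open>The expansion of the form contains a cross term, the sum of spectral integrals
      does not; comparing them shows that it vanishes.\<close>
    have 0: "Re (ip (\<lambda>x. P m f x - P n f x) h) = 0" if "n \<le> m" for m
    proof -
      let ?\<psi> = "\<lambda>x. P m f x - P n f x"
      have \<psi>: "?\<psi> \<in> Q"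
        by (rule slice_in_Q[OF fL2 _ that ae_eq_refl]) (intro L2_diff P_L2 fL2)
      have sum: "(\<lambda>x. ?\<psi> x + F n x) = F m" by (auto simp: F_def)
      have "a \<le> m" using \<open>a \<le> n\<close> that by simp
      have "F m \<in> Q"
        by (rule slice_in_Q[OF fL2 FL2 \<open>a \<le> m\<close>]) (simp add: F_def)
      then have "Re (q (F m) (F m)) = Re (q ?\<psi> ?\<psi>) + Re (q (F n) (F n)) + 2 * Re (q ?\<psi> (F n))"
        using q_add[OF \<psi> FQ] unfolding sum by simp
      moreover have "Re (q (F m) (F m)) = Re (q ?\<psi> ?\<psi>) + Re (q (F n) (F n))"
        unfolding F_def by (rule slice_add[OF fL2 \<open>a \<le> n\<close> that])
      ultimately show ?thesis using qh[OF \<psi>] by simp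
    qed
    \<comment> \<open>The remainder need not lie in the operator domain. Since \<open>F n\<close>
      does, the cross term is an inner product with the fixed vector \<open>h\<close>, hence
      continuous in the norm, and orthogonality survives the limit in \<open>m\<close>.\<close>
    have "((\<lambda>m. L2norm (\<lambda>x. (P m f x - P n f x) - (f x - P n f x))) \<longlongrightarrow> 0) at_top"
      using lim by simp
    then have "((\<lambda>m. ip (\<lambda>x. P m f x - P n f x) h) \<longlongrightarrow> ip (\<lambda>x. f x - P n f x) h) at_top"
      by (intro ip_tendsto_left L2_diff P_L2 fL2 hL2)
    then have "((\<lambda>m. Re (ip (\<lambda>x. P m f x - P n f x) h)) \<longlongrightarrow> Re (ip (\<lambda>x. f x - P n f x) h)) at_top"
      by (rule tendsto_Re)
    moreover have "\<forall>\<^sub>F m in at_top. Re (ip (\<lambda>x. P m f x - P n f x) h) = 0"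
      using eventually_ge_at_top[of n] by eventually_elim (rule 0)
    ultimately have "Re (ip (\<lambda>x. f x - P n f x) h) = 0"
      by (rule tendsto_unique[OF trivial_limit_at_top_linorder _ tendsto_eventually])
    also have "ip (\<lambda>x. f x - P n f x) h = ip (\<lambda>x. f x - F n x) h"
      by (intro ip_cong ae_eq_diff ae_eq_refl ae_eq_sym[OF F_ae] L2_diff P_L2 fL2 FL2 hL2)
    also have "\<dots> = q (\<lambda>x. f x - F n x) (F n)"
      using qh[OF Q_diff[OF f FQ]] by simp
    finally have "Re (q f f) = Re (q (\<lambda>x. f x - F n x) (\<lambda>x. f x - F n x)) + Re (q (F n) (F n))"
      using q_add[OF Q_diff[OF f FQ] FQ] f by simp
    \<comment> \<open>As \<open>P l f\<close> is null, \<open>F n\<close> is also a slice over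
      \<open>{l<..n}\<close>, which improves its lower bound from \<open>a\<close> to
      \<open>l\<close>.\<close>
    moreover have "l * (L2norm (F n))\<^sup>2 \<le> Re (q (F n) (F n))"
    proof (rule slice_lower[OF fL2 FL2 \<open>l \<le> n\<close>])
      have "ae_eq (P n f) (\<lambda>x. P n f x - P l f x)"
        using ae_eq_sym[OF ae_eq_diff[OF ae_eq_refl l], of "P n f"] by simp
      then show "ae_eq (F n) (\<lambda>x. P n f x - P l f x)"
        by (rule ae_eq_trans[OF F_ae])
    qed
    ultimately show ?thesis
      using c[OF Q_diff[OF f FQ]] by (simp add: L2norm_diff_commute[of f])
  qed
  have "((\<lambda>n. c * (L2norm (\<lambda>x. F n x - f x))\<^sup>2 + l * (L2norm (F n))\<^sup>2) \<longlongrightarrow>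
      c * 0\<^sup>2 + l * (L2norm f)\<^sup>2) at_top"
    using lim unfolding F_norm[symmetric] by (intro tendsto_intros L2norm_tendsto FL2 fL2)
  moreover have "\<forall>\<^sub>F n in at_top. c * (L2norm (\<lambda>x. F n x - f x))\<^sup>2 + l * (L2norm (F n))\<^sup>2 \<le> Re (q f f)"
    using eventually_ge_at_top[of l] by eventually_elim (rule bound)
  ultimately have "c * 0\<^sup>2 + l * (L2norm f)\<^sup>2 \<le> Re (q f f)"
    by (rule tendsto_upperbound) simp
  then show ?thesis by simp
qed

section \<open>Ranks of the spectral projections\<close>

lemma bdd_below_dim_ge:
  assumes "1 \<le> j"
  shows "bdd_below {l. dim_ge (P l ` L2) j}"
proof -
  obtain c where c: "\<And>f. f \<in> Q \<Longrightarrow> c * (L2norm f)\<^sup>2 \<le> Re (q f f)"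
    using lower_bound by blast
  have "c \<le> l" if "dim_ge (P l ` L2) j" for l
  proof (rule ccontr)
    assume "\<not> c \<le> l"
    then have "l < c" by simp
    from that obtain v where v: "(\<forall>i<j. v i \<in> P l ` L2) \<and>
        (\<forall>a. ae_eq (\<lambda>x. \<Sum>i<j. a i * v i x) (\<lambda>x. 0) \<longrightarrow> (\<forall>i<j. a i = 0))"
      unfolding dim_ge_def by (elim exE)
    note ind = v[THEN conjunct2, rule_format]
    have "v 0 \<in> P l ` L2" using v assms by simp
    then obtain w where w: "w \<in> L2" "v 0 = P l w" by blast
    have "ae_eq (v 0) (\<lambda>x. 0)"
      unfolding w(2) using c \<open>l < c\<close> w(1) by (rule P_eventually_0)
    \<comment> \<open>Coefficients that pick out the null vector \<open>v 0\<close> form a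
      nontrivial relation, available because \<open>1 \<le> j\<close>.\<close>
    moreover have "(\<Sum>i<j. (if i = 0 then 1 else 0) * v i x) = v 0 x" for x
    proof -
      have "(\<Sum>i<j. (if i = 0 then 1 else 0) * v i x) = (\<Sum>i<j. if i = 0 then v i x else 0)"
        by (intro sum.cong) simp_all
      then show ?thesis using assms by simp
    qed
    ultimately have "ae_eq (\<lambda>x. \<Sum>i<j. (if i = 0 then 1 else 0) * v i x) (\<lambda>x. 0)"
      by simp
    from ind[OF this, of 0] show False using assms by simp
  qed
  then show ?thesis by (auto intro!: bdd_belowI)
qed

text \<open>The projections tend strongly to the identity, so for large \<open>t\<close> they move
  finitely many orthonormal vectors too little to make them dependent. Nonemptiness matters because
  the infimum of the empty set carries no information.\<close>

lemma dim_ge_exists: "\<exists>l. dim_ge (P l ` L2) j"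
proof -
  obtain e :: "nat \<Rightarrow> real^'n \<Rightarrow> complex" where e: "\<And>i. e i \<in> L2"
    and orth: "\<And>i k. ip (e i) (e k) = (if i = k then 1 else 0)"
    using orthonormal_sequence_exists by blast
  have e_norm: "L2norm (e i) = 1" for i
  proof -
    have "complex_of_real ((L2norm (e i))\<^sup>2) = 1"
      unfolding ip_self[symmetric] orth by simp
    then have "(L2norm (e i))\<^sup>2 = 1" unfolding of_real_eq_1_iff .
    then show ?thesis using L2norm_nonneg[of "e i"] by (simp add: power2_eq_1_iff)
  qed
  \<comment> \<open>With errors below \<open>1 / (real j + 1)\<close>, adding up \<open>j\<close>
    coefficient bounds gives \<open>S * (real j + 1) \<le> real j * S\<close>, so \<open>S\<close>
    cannot be positive.\<close>
  have "\<forall>\<^sub>F t in at_top. L2norm (\<lambda>x. P t (e i) x - e i x) < 1 / (real j + 1)" for i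
  proof (rule order_tendstoD(2))
    show "((\<lambda>t. L2norm (\<lambda>x. P t (e i) x - e i x)) \<longlongrightarrow> 0) at_top"
      using spectral_family e by (simp add: spectral_family_def)
  qed simp
  then have "\<forall>\<^sub>F t in at_top. \<forall>i\<in>{..<j}. L2norm (\<lambda>x. P t (e i) x - e i x) < 1 / (real j + 1)"
    by (intro eventually_ball_finite) auto
  then obtain t where t: "\<And>i. i < j \<Longrightarrow> L2norm (\<lambda>x. P t (e i) x - e i x) < 1 / (real j + 1)"
    unfolding eventually_at_top_linorder by blast
  have "a k = 0" if a: "ae_eq (\<lambda>x. \<Sum>i<j. a i * P t (e i) x) (\<lambda>x. 0)" and "k < j" for a k
  proof -
    define g where "g x = (\<Sum>i<j. a i * e i x)" for x
    define S where "S = (\<Sum>i<j. cmod (a i))"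
    have g: "g \<in> L2" unfolding g_def by (intro L2_sum e)
    have g_norm: "L2norm g \<le> S"
      using L2norm_sum_le[of "{..<j}" e a] e by (simp add: e_norm g_def[abs_def] S_def)
    have Pg: "ae_eq (P t g) (\<lambda>x. 0)"
      unfolding g_def by (rule ae_eq_trans[OF P_sum a]) (rule e)
    have bound: "cmod (a i) \<le> 1 / (real j + 1) * S" if "i < j" for i
    proof -
      have "ip (e i) g = (\<Sum>k<j. a k * (if i = k then 1 else 0))"
        unfolding g_def by (subst ip_sum_right) (auto simp: e orth)
      also have "\<dots> = (\<Sum>k<j. if i = k then a k else 0)"
        by (intro sum.cong) simp_all
      also have "\<dots> = a i" using that by simp
      finally have "a i = ip (e i) g" by simp
      \<comment> \<open>By symmetry \<open>P t (e i)\<close> pairs with \<open>g\<close> as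
        \<open>e i\<close> does with the null function \<open>P t g\<close>, so only the small error
        remains.\<close>
      also have "\<dots> = - ip (\<lambda>x. P t (e i) x - e i x) g"
        using ip_zero_right[OF Pg e P_L2[OF g], of i] by (simp add: ip_diff_left g e P_L2 P_sym)
      finally have "cmod (a i) \<le> L2norm (\<lambda>x. P t (e i) x - e i x) * L2norm g"
        using cauchy_schwarz_ip[of "\<lambda>x. P t (e i) x - e i x" g] by (simp add: L2_diff P_L2 e g)
      also have "\<dots> \<le> 1 / (real j + 1) * S"
        using t[OF that] g_norm by (intro mult_mono) simp_all
      finally show ?thesis .
    qed
    have "S \<le> (\<Sum>i<j. 1 / (real j + 1) * S)"
      unfolding S_def[symmetric] by (subst S_def, rule sum_mono, rule bound) simp
    then have "S * (real j + 1) \<le> real j * S" by (simp add: field_simps)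
    then have "S \<le> 0" by (simp add: algebra_simps)
    moreover have "cmod (a k) \<le> S"
      using member_le_sum[of k "{..<j}" "\<lambda>i. cmod (a i)"] \<open>k < j\<close> by (simp add: S_def)
    ultimately have "cmod (a k) \<le> 0" by linarith
    then show "a k = 0" by simp
  qed
  then have "dim_ge (P t ` L2) j"
    unfolding dim_ge_def using e by (intro exI[of _ "\<lambda>i. P t (e i)"]) blast
  then show ?thesis by blast
qed

text \<open>Otherwise the projection would annihilate a nonzero combination of the \<open>v i\<close>, on which the
  form would be both at least \<open>l'\<close> and at most \<open>l\<close> times the squared norm.\<close>

lemma dim_ge_if_form_upper:
  assumes "l < l'"
    and comb: "\<And>c. (\<lambda>x. \<Sum>i<j. c i * v i x) \<in> Q"
    and v: "\<And>i. i < j \<Longrightarrow> v i \<in> L2"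
    and upper: "\<And>c. Re (q (\<lambda>x. \<Sum>i<j. c i * v i x) (\<lambda>x. \<Sum>i<j. c i * v i x)) \<le>
      l * (L2norm (\<lambda>x. \<Sum>i<j. c i * v i x))\<^sup>2"
    and ind: "\<And>c. ae_eq (\<lambda>x. \<Sum>i<j. c i * v i x) (\<lambda>x. 0) \<Longrightarrow> \<forall>i<j. c i = 0"
  shows "dim_ge (P l' ` L2) j"
  unfolding dim_ge_def
proof (intro exI[of _ "\<lambda>i. P l' (v i)"] conjI allI impI)
  show "P l' (v i) \<in> P l' ` L2" if "i < j" for i using v[OF that] by blast
  fix c i assume c: "ae_eq (\<lambda>x. \<Sum>i<j. c i * P l' (v i) x) (\<lambda>x. 0)" and "i < j"
  let ?f = "\<lambda>x. \<Sum>i<j. c i * v i x"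
  have "ae_eq (P l' ?f) (\<lambda>x. 0)"
    by (rule ae_eq_trans[OF P_sum c]) (simp add: v)
  then have "l' * (L2norm ?f)\<^sup>2 \<le> l * (L2norm ?f)\<^sup>2"
    using form_lower_on_kernel[OF comb] upper order_trans by blast
  then have "(l' - l) * (L2norm ?f)\<^sup>2 \<le> 0" by (simp add: left_diff_distrib)
  then have "L2norm ?f = 0"
    using \<open>l < l'\<close> zero_le_power2[of "L2norm ?f"] by (auto simp: mult_le_0_iff)
  moreover have "?f \<in> L2" using comb Q_L2 by blast
  ultimately have "ae_eq ?f (\<lambda>x. 0)" by (simp only: L2norm_eq_0_iff)
  then show "c i = 0" using ind \<open>i < j\<close> by blast
qed

end

section \<open>Ground state forms\<close>

lemma locally_integrable_add_scaled:
  assumes "locally_integrable f" "locally_integrable h"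
  shows "locally_integrable (\<lambda>x. f x + c * h x)"
  using assms unfolding locally_integrable_def
  by (intro allI impI set_integral_add(1) set_integrable_mult_right) simp_all

text \<open>Used with \<open>c = - 1\<close> for closure of the form domain under differences and
  with \<open>c = 1\<close> for additivity of the form.\<close>

lemma has_dist_grad_add_scaled:
  assumes g: "has_dist_grad g G" and h: "has_dist_grad h H"
  shows "has_dist_grad (\<lambda>x. g x + c * h x) (\<lambda>x. \<chi> i. G x $ i + c * H x $ i)"
proof -
  have loc: "locally_integrable g" "locally_integrable h" "locally_integrable (\<lambda>x. G x $ i)"
    "locally_integrable (\<lambda>x. H x $ i)" for i
    using g h by (auto simp: has_dist_grad_def)
  have "(LINT x|lebesgue. (g x + c * h x) * complex_of_real (partial i \<phi> x)) =
        - (LINT x|lebesgue. (G x $ i + c * H x $ i) * complex_of_real (\<phi> x))"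
    if \<phi>: "test_function \<phi>" for \<phi> i
  proof -
    note int0 = integrable_times_test_function(1)[OF _ \<phi>]
      and int1 = integrable_times_test_function(2)[OF _ \<phi>]
    have "(LINT x|lebesgue. (g x + c * h x) * complex_of_real (partial i \<phi> x)) =
        (LINT x|lebesgue. g x * complex_of_real (partial i \<phi> x)) +
        c * (LINT x|lebesgue. h x * complex_of_real (partial i \<phi> x))"
      using int1[OF loc(1), of i] int1[OF loc(2), of i] by (simp add: distrib_right mult.assoc)
    also have "\<dots> = - (LINT x|lebesgue. G x $ i * complex_of_real (\<phi> x)) +
        c * - (LINT x|lebesgue. H x $ i * complex_of_real (\<phi> x))"
      using g h \<phi> by (simp add: has_dist_grad_def)
    also have "\<dots> = - (LINT x|lebesgue. (G x $ i + c * H x $ i) * complex_of_real (\<phi> x))"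
      using int0[OF loc(3), of i] int0[OF loc(4), of i] by (simp add: distrib_right mult.assoc)
    finally show ?thesis .
  qed
  then show ?thesis
    unfolding has_dist_grad_def using loc by (simp add: locally_integrable_add_scaled)
qed

lemma has_dist_grad_dist_grad: "has_dist_grad g G \<Longrightarrow> has_dist_grad g (dist_grad g)"
  unfolding dist_grad_def by (rule someI[where P = "has_dist_grad g"])

lemma norm_vec_sq: "(norm (z :: complex^'n))\<^sup>2 = (\<Sum>i\<in>UNIV. (cmod (z $ i))\<^sup>2)"
  by (simp add: norm_vec_def L2_set_def sum_nonneg)

lemma has_dist_grad_measurable:
  assumes "has_dist_grad g G"
  shows "(\<lambda>x. G x $ i) \<in> borel_measurable lebesgue" "(\<lambda>x. (norm (G x))\<^sup>2) \<in> borel_measurable lebesgue"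
proof -
  show "(\<lambda>x. G x $ i) \<in> borel_measurable lebesgue" for i
    using assms by (intro locally_integrable_measurable) (simp add: has_dist_grad_def)
  note [measurable] = this
  show "(\<lambda>x. (norm (G x))\<^sup>2) \<in> borel_measurable lebesgue"
    unfolding norm_vec_sq by measurable
qed

section \<open>The form domain and the form of a single weight\<close>

locale weight =
  fixes u :: "real^'n \<Rightarrow> real"
  assumes u_continuous: "continuous_on UNIV u" and u_pos: "\<And>x. u x > 0"
begin

lemma u_measurable [measurable]: "u \<in> borel_measurable lebesgue"
  by (intro borel_imp_lebesgue borel_measurable_continuous_onI u_continuous)

definition grad :: "(real^'n \<Rightarrow> complex) \<Rightarrow> real^'n \<Rightarrow> complex^'n" where
  "grad f = dist_grad (\<lambda>y. f y / complex_of_real (u y))"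

lemma form_domI:
  assumes "f \<in> L2" "has_dist_grad (\<lambda>y. f y / complex_of_real (u y)) G"
    "integrable lebesgue (\<lambda>x. (norm (G x))\<^sup>2 * (u x)\<^sup>2)"
  shows "f \<in> form_dom u"
  unfolding form_dom_def mem_Collect_eq
proof (intro exI[of _ "\<lambda>y. f y / complex_of_real (u y)"] conjI)
  have u0: "u x \<noteq> 0" for x using u_pos[of x] by simp
  show "f = (\<lambda>x. f x / complex_of_real (u x) * complex_of_real (u x))"
    using u0 by simp
  show "(\<lambda>y. f y / complex_of_real (u y)) \<in> borel_measurable lebesgue"
    using L2_measurable[OF assms(1)] by measurable
  show "integrable lebesgue (\<lambda>x. (cmod (f x / complex_of_real (u x)))\<^sup>2 * (u x)\<^sup>2)"
    using assms(1) u0 by (simp add: L2_def norm_divide power_divide)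
  show "\<exists>G. has_dist_grad (\<lambda>y. f y / complex_of_real (u y)) G \<and>
      integrable lebesgue (\<lambda>x. (norm (G x))\<^sup>2 * (u x)\<^sup>2)"
    using assms by blast
qed

text \<open>Since \<open>u\<close> has no zeros, \<open>g\<close> is recovered as the quotient by
  \<open>u\<close>. The domain only provides some gradient of finite energy; uniqueness transfers
  this to the chosen gradient, which enters the form.\<close>

lemma form_domD:
  assumes "f \<in> form_dom u"
  shows form_dom_L2: "f \<in> L2"
    and form_dom_grad: "has_dist_grad (\<lambda>y. f y / complex_of_real (u y)) (grad f)"
    and form_dom_grad_integrable: "integrable lebesgue (\<lambda>x. (norm (grad f x))\<^sup>2 * (u x)\<^sup>2)"
proof -
  obtain g G where f: "f = (\<lambda>x. g x * complex_of_real (u x))"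
    and g: "g \<in> borel_measurable lebesgue" "integrable lebesgue (\<lambda>x. (cmod (g x))\<^sup>2 * (u x)\<^sup>2)"
    and G: "has_dist_grad g G" "integrable lebesgue (\<lambda>x. (norm (G x))\<^sup>2 * (u x)\<^sup>2)"
    using assms unfolding form_dom_def by blast
  have u0: "u x \<noteq> 0" for x using u_pos[of x] by simp
  have fg: "(\<lambda>y. f y / complex_of_real (u y)) = g"
    using u0 by (simp add: f)
  note [measurable] = g(1)
  show "f \<in> L2"
    using g(2) unfolding L2_def f by (simp add: norm_mult power_mult_distrib)
  show grad: "has_dist_grad (\<lambda>y. f y / complex_of_real (u y)) (grad f)"
    unfolding grad_def fg by (rule has_dist_grad_dist_grad[OF G(1)])
  have "AE x in lebesgue. G x = grad f x"
    using has_dist_grad_unique[OF G(1)] grad unfolding fg .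
  then have "AE x in lebesgue. (norm (G x))\<^sup>2 * (u x)\<^sup>2 = (norm (grad f x))\<^sup>2 * (u x)\<^sup>2"
    by eventually_elim simp
  then show "integrable lebesgue (\<lambda>x. (norm (grad f x))\<^sup>2 * (u x)\<^sup>2)"
    using has_dist_grad_measurable(2)[OF grad]
    by (intro integrable_cong_AE_imp[OF G(2)]) (auto elim: AE_mp)
qed

lemma grad_measurable:
  "f \<in> form_dom u \<Longrightarrow> (\<lambda>x. grad f x $ i) \<in> borel_measurable lebesgue"
  using has_dist_grad_measurable(1)[OF form_dom_grad] .

lemma form_dom_diff:
  assumes f: "f \<in> form_dom u" and h: "h \<in> form_dom u"
  shows "(\<lambda>x. f x - h x) \<in> form_dom u"
proof (rule form_domI)
  show "(\<lambda>x. f x - h x) \<in> L2" by (intro L2_diff form_dom_L2 f h)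
  let ?G = "\<lambda>x. \<chi> i. grad f x $ i + (- 1) * grad h x $ i"
  have eq: "(\<lambda>y. (f y - h y) / complex_of_real (u y)) =
      (\<lambda>y. f y / complex_of_real (u y) + (- 1) * (h y / complex_of_real (u y)))"
    by (simp add: diff_divide_distrib)
  show G: "has_dist_grad (\<lambda>y. (f y - h y) / complex_of_real (u y)) ?G"
    unfolding eq by (intro has_dist_grad_add_scaled form_dom_grad f h)
  have "?G x = grad f x - grad h x" for x
    by (simp add: vec_eq_iff)
  note G_eq = this
  show "integrable lebesgue (\<lambda>x. (norm (?G x))\<^sup>2 * (u x)\<^sup>2)"
  proof (rule Bochner_Integration.integrable_bound)
    show "integrable lebesgue (\<lambda>x. 2 * ((norm (grad f x))\<^sup>2 * (u x)\<^sup>2) + 2 * ((norm (grad h x))\<^sup>2 * (u x)\<^sup>2))"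
      using form_dom_grad_integrable[OF f] form_dom_grad_integrable[OF h] by simp
    show "(\<lambda>x. (norm (?G x))\<^sup>2 * (u x)\<^sup>2) \<in> borel_measurable lebesgue"
      by (rule borel_measurable_times[OF has_dist_grad_measurable(2)[OF G] borel_measurable_power[OF u_measurable]])
    have "(norm (?G x))\<^sup>2 * (u x)\<^sup>2 \<le> 2 * ((norm (grad f x))\<^sup>2 * (u x)\<^sup>2) + 2 * ((norm (grad h x))\<^sup>2 * (u x)\<^sup>2)"
      (is "?L x \<le> ?R x") for x
    proof -
      have "(norm (grad f x - grad h x))\<^sup>2 \<le> (norm (grad f x) + norm (grad h x))\<^sup>2"
        by (intro power_mono norm_triangle_ineq4) simp
      also have "\<dots> \<le> 2 * (norm (grad f x))\<^sup>2 + 2 * (norm (grad h x))\<^sup>2"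
        using sum_squares_bound[of "norm (grad f x)" "norm (grad h x)"] by (simp add: power2_sum)
      finally have "(norm (?G x))\<^sup>2 * (u x)\<^sup>2 \<le> (2 * (norm (grad f x))\<^sup>2 + 2 * (norm (grad h x))\<^sup>2) * (u x)\<^sup>2"
        unfolding G_eq by (rule mult_right_mono) simp
      then show ?thesis by (simp add: distrib_right)
    qed
    then show "AE x in lebesgue. norm (?L x) \<le> norm (?R x)"
      by simp
  qed
qed

lemma grad_add:
  assumes f: "f \<in> form_dom u" and h: "h \<in> form_dom u" and s: "(\<lambda>x. f x + h x) \<in> form_dom u"
  shows "AE x in lebesgue. grad (\<lambda>x. f x + h x) x = grad f x + grad h x"
proof -
  have eq: "(\<lambda>y. (f y + h y) / complex_of_real (u y)) =
      (\<lambda>y. f y / complex_of_real (u y) + 1 * (h y / complex_of_real (u y)))"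
    by (simp add: add_divide_distrib)
  have "has_dist_grad (\<lambda>y. (f y + h y) / complex_of_real (u y))
      (\<lambda>x. \<chi> i. grad f x $ i + 1 * grad h x $ i)"
    unfolding eq by (intro has_dist_grad_add_scaled form_dom_grad f h)
  from has_dist_grad_unique[OF form_dom_grad[OF s] this]
  show ?thesis by eventually_elim (simp add: vec_eq_iff)
qed

text \<open>One factor \<open>u x\<close> of the weight goes to each gradient, so that every
  component is a product of two square-integrable functions.\<close>

lemma kinetic_integrable:
  assumes f: "f \<in> form_dom u" and h: "h \<in> form_dom u"
  shows "integrable lebesgue (\<lambda>x. (\<Sum>i\<in>UNIV. cnj (grad f x $ i) * grad h x $ i) * complex_of_real ((u x)\<^sup>2))"
proof -
  have sq: "integrable lebesgue (\<lambda>x. (cmod (grad f x $ i * complex_of_real (u x)))\<^sup>2)" if f: "f \<in> form_dom u" for f i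
  proof (rule Bochner_Integration.integrable_bound[OF form_dom_grad_integrable[OF f]])
    note [measurable] = grad_measurable[OF f]
    show "(\<lambda>x. (cmod (grad f x $ i * complex_of_real (u x)))\<^sup>2) \<in> borel_measurable lebesgue"
      by measurable
    have "(cmod (grad f x $ i))\<^sup>2 * (u x)\<^sup>2 \<le> (norm (grad f x))\<^sup>2 * (u x)\<^sup>2" for x
      by (intro mult_right_mono power_mono Finite_Cartesian_Product.norm_nth_le) simp_all
    then show "AE x in lebesgue. norm ((cmod (grad f x $ i * complex_of_real (u x)))\<^sup>2) \<le>
        norm ((norm (grad f x))\<^sup>2 * (u x)\<^sup>2)"
      by (simp add: norm_mult power_mult_distrib)
  qed
  have "integrable lebesgue (\<lambda>x. cnj (grad f x $ i * complex_of_real (u x)) * (grad h x $ i * complex_of_real (u x)))" for i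
  proof (rule integrable_mult_square)
    note [measurable] = grad_measurable[OF f] grad_measurable[OF h]
    show "(\<lambda>x. cnj (grad f x $ i * complex_of_real (u x))) \<in> borel_measurable lebesgue"
      "(\<lambda>x. grad h x $ i * complex_of_real (u x)) \<in> borel_measurable lebesgue"
      by measurable
  qed (use sq[OF f] sq[OF h] in \<open>simp_all add: norm_mult\<close>)
  then have "integrable lebesgue (\<lambda>x. \<Sum>i\<in>UNIV. cnj (grad f x $ i * complex_of_real (u x)) * (grad h x $ i * complex_of_real (u x)))"
    by (intro Bochner_Integration.integrable_sum)
  then show ?thesis
    by (simp add: sum_distrib_left sum_distrib_right power2_eq_square mult_ac)
qed

text \<open>Admissibility controls the diagonal only; off the diagonal the product of the moduli is
  dominated by the sum of their squares.\<close>

lemma potential_integrable: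
  assumes adm: "admissible_potential u W" and f: "f \<in> form_dom u" and h: "h \<in> form_dom u"
  shows "integrable lebesgue (\<lambda>x. complex_of_real (W x) * (cnj (f x) * h x))"
proof (rule Bochner_Integration.integrable_bound)
  have [measurable]: "W \<in> borel_measurable lebesgue" "f \<in> borel_measurable lebesgue" "h \<in> borel_measurable lebesgue"
    using adm form_dom_L2[OF f] form_dom_L2[OF h] by (auto simp: admissible_potential_def L2_def)
  show "integrable lebesgue (\<lambda>x. \<bar>W x * (cmod (f x))\<^sup>2\<bar> + \<bar>W x * (cmod (h x))\<^sup>2\<bar>)"
    using adm f h by (intro Bochner_Integration.integrable_add integrable_abs) (auto simp: admissible_potential_def)
  show "(\<lambda>x. complex_of_real (W x) * (cnj (f x) * h x)) \<in> borel_measurable lebesgue"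
    by measurable
  have "\<bar>W x\<bar> * (cmod (f x) * cmod (h x)) \<le> \<bar>W x\<bar> * ((cmod (f x))\<^sup>2 + (cmod (h x))\<^sup>2)" for x
  proof (rule mult_left_mono)
    have "0 \<le> cmod (f x) * cmod (h x)" by simp
    then show "cmod (f x) * cmod (h x) \<le> (cmod (f x))\<^sup>2 + (cmod (h x))\<^sup>2"
      using sum_squares_bound[of "cmod (f x)" "cmod (h x)"] unfolding mult.assoc by linarith
  qed simp
  then show "AE x in lebesgue. norm (complex_of_real (W x) * (cnj (f x) * h x)) \<le>
      norm (\<bar>W x * (cmod (f x))\<^sup>2\<bar> + \<bar>W x * (cmod (h x))\<^sup>2\<bar>)"
    by (simp add: norm_mult abs_mult distrib_left)
qed

text \<open>The two cross terms are complex conjugates, so their real parts coincide. The kinetic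
  integrands match almost everywhere only, because the gradients are chosen separately.\<close>

lemma gs_form_add:
  assumes adm: "admissible_potential u W"
    and f: "f \<in> form_dom u" and h: "h \<in> form_dom u" and s: "(\<lambda>x. f x + h x) \<in> form_dom u"
  shows "Re (gs_form u W (\<lambda>x. f x + h x) (\<lambda>x. f x + h x)) =
    Re (gs_form u W f f) + Re (gs_form u W h h) + 2 * Re (gs_form u W f h)"
proof -
  define K where "K f h x = (\<Sum>i\<in>UNIV. cnj (grad f x $ i) * grad h x $ i) * complex_of_real ((u x)\<^sup>2)" for f h x
  define U where "U f h x = complex_of_real (W x) * (cnj (f x) * h x)" for f h x
  have form: "gs_form u W f h = (LINT x|lebesgue. K f h x) + (LINT x|lebesgue. U f h x)" for f h
    by (simp add: gs_form_def K_def U_def grad_def)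
  have intK: "integrable lebesgue (K f h)" if "f \<in> form_dom u" "h \<in> form_dom u" for f h
    using kinetic_integrable[OF that] by (simp add: K_def[abs_def])
  have intU: "integrable lebesgue (U f h)" if "f \<in> form_dom u" "h \<in> form_dom u" for f h
    using potential_integrable[OF adm that] by (simp add: U_def[abs_def])
  have cnj: "Re (LINT x|lebesgue. K h f x) = Re (LINT x|lebesgue. K f h x)"
    "Re (LINT x|lebesgue. U h f x) = Re (LINT x|lebesgue. U f h x)"
  proof -
    have "K h f x = cnj (K f h x)" "U h f x = cnj (U f h x)" for x
      by (simp_all add: K_def U_def mult_ac)
    then show "Re (LINT x|lebesgue. K h f x) = Re (LINT x|lebesgue. K f h x)"
      "Re (LINT x|lebesgue. U h f x) = Re (LINT x|lebesgue. U f h x)"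
      by (simp_all add: Bochner_Integration.integral_cnj)
  qed
  let ?s = "\<lambda>x. f x + h x"
  have "(LINT x|lebesgue. K ?s ?s x) = (LINT x|lebesgue. K f f x + K f h x + (K h f x + K h h x))"
  proof (rule integral_cong_AE)
    show "AE x in lebesgue. K ?s ?s x = K f f x + K f h x + (K h f x + K h h x)"
      using grad_add[OF f h s]
      by eventually_elim (simp add: K_def ring_distribs sum.distrib)
  qed (use intK f h s in \<open>auto intro!: borel_measurable_add borel_measurable_integrable\<close>)
  also have "\<dots> = (LINT x|lebesgue. K f f x) + (LINT x|lebesgue. K f h x) +
      ((LINT x|lebesgue. K h f x) + (LINT x|lebesgue. K h h x))"
    using intK f h by simp
  finally have 1: "(LINT x|lebesgue. K ?s ?s x) = \<dots>" .
  have "(LINT x|lebesgue. U ?s ?s x) = (LINT x|lebesgue. U f f x + U f h x + (U h f x + U h h x))"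
    by (intro Bochner_Integration.integral_cong) (simp_all add: U_def ring_distribs)
  also have "\<dots> = (LINT x|lebesgue. U f f x) + (LINT x|lebesgue. U f h x) +
      ((LINT x|lebesgue. U h f x) + (LINT x|lebesgue. U h h x))"
    using intU f h by simp
  finally have 2: "(LINT x|lebesgue. U ?s ?s x) = \<dots>" .
  show ?thesis
    unfolding form 1 2 by (simp add: cnj)
qed

lemma gs_form_diagonal:
  "Re (gs_form u W f f) = (LINT x|lebesgue. (norm (grad f x))\<^sup>2 * (u x)\<^sup>2) + (LINT x|lebesgue. W x * (cmod (f x))\<^sup>2)"
proof -
  have cz: "cnj z * z = complex_of_real ((cmod z)\<^sup>2)" for z
    by (simp add: complex_norm_square mult.commute del: of_real_power)
  have "gs_form u W f f = (LINT x|lebesgue. complex_of_real ((norm (grad f x))\<^sup>2 * (u x)\<^sup>2)) +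
      (LINT x|lebesgue. complex_of_real (W x * (cmod (f x))\<^sup>2))"
    unfolding gs_form_def grad_def cz norm_vec_sq by simp
  then show ?thesis by (simp only: integral_complex_of_real) simp
qed

lemma form_spectral_family_gs_form:
  assumes "admissible_potential u W" "spectral_family (schroedinger_op u W) P"
  shows "form_spectral_family (form_dom u) (gs_form u W) P"
proof
  show "form_dom u \<subseteq> L2" using form_dom_L2 by blast
  show "bounded_below_form (form_dom u) (gs_form u W)"
    using assms by (simp add: admissible_potential_def)
  show "spectral_family (form_operator (form_dom u) (gs_form u W)) P"
    using assms by (simp add: schroedinger_op_def)
qed (use assms in \<open>simp_all add: form_dom_diff gs_form_add\<close>)

end

section \<open>Comparison of the two ground state forms\<close>

lemma integrable_mult_weight_le:
  fixes r s :: "real^'n \<Rightarrow> real"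
  assumes "integrable lebesgue (\<lambda>x. N x * (s x)\<^sup>2)" "(\<lambda>x. N x * (r x)\<^sup>2) \<in> borel_measurable lebesgue"
    and "\<And>x. 0 \<le> N x" and rs: "\<And>x. 0 \<le> r x \<and> m * r x \<le> s x" and "0 < m"
  shows "integrable lebesgue (\<lambda>x. N x * (r x)\<^sup>2)"
    and "(LINT x|lebesgue. N x * (r x)\<^sup>2) \<le> (LINT x|lebesgue. N x * (s x)\<^sup>2) / m\<^sup>2"
proof -
  have le: "N x * (r x)\<^sup>2 \<le> N x * (s x)\<^sup>2 / m\<^sup>2" for x
  proof -
    have "(m * r x)\<^sup>2 \<le> (s x)\<^sup>2"
      using rs[of x] \<open>0 < m\<close> by (intro power_mono) simp_all
    then have "(r x)\<^sup>2 \<le> (s x)\<^sup>2 / m\<^sup>2"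
      using \<open>0 < m\<close> by (simp add: field_simps power_mult_distrib)
    then have "N x * (r x)\<^sup>2 \<le> N x * ((s x)\<^sup>2 / m\<^sup>2)"
      using assms(3) by (rule mult_left_mono)
    then show ?thesis by simp
  qed
  have int: "integrable lebesgue (\<lambda>x. N x * (s x)\<^sup>2 / m\<^sup>2)"
    using assms(1) by simp
  show 1: "integrable lebesgue (\<lambda>x. N x * (r x)\<^sup>2)"
    by (rule Bochner_Integration.integrable_bound[OF int assms(2)]) (use le assms(3) in \<open>simp add: abs_mult\<close>)
  have "(LINT x|lebesgue. N x * (r x)\<^sup>2) \<le> (LINT x|lebesgue. N x * (s x)\<^sup>2 / m\<^sup>2)"
    by (rule integral_mono[OF 1 int le])
  then show "(LINT x|lebesgue. N x * (r x)\<^sup>2) \<le> (LINT x|lebesgue. N x * (s x)\<^sup>2) / m\<^sup>2"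
    by simp
qed

text \<open>Kinetic energy and squared norm are both integrals of a fixed nonnegative function
  against a squared weight, so the bound with \<open>m\<close> serves both. The bound with
  \<open>M\<close> acts in the potential term alone.\<close>

lemma form_comparison:
  fixes u0 u1 V :: "real^'n \<Rightarrow> real"
  assumes "weight u0" "weight u1" and "0 < m" "0 < M"
    and m: "\<And>x. m * u1 x \<le> u0 x" and M: "\<And>x. u0 x \<le> M * u1 x"
    and V: "AE x in lebesgue. V x \<le> 0"
    and adm0: "admissible_potential u0 V" and adm1: "admissible_potential u1 (\<lambda>x. (M / m)\<^sup>2 * V x)"
    and f: "f \<in> form_dom u0" and "l \<le> 0" and le: "Re (gs_form u0 V f f) \<le> l * (L2norm f)\<^sup>2"
  defines "f' \<equiv> \<lambda>x. f x * complex_of_real (u1 x / u0 x)"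
  shows "f' \<in> form_dom u1"
    and "Re (gs_form u1 (\<lambda>x. (M / m)\<^sup>2 * V x) f' f') \<le> l * (L2norm f')\<^sup>2"
proof -
  interpret w0: weight u0 by fact
  interpret w1: weight u1 by fact
  let ?\<beta> = "(M / m)\<^sup>2"
  have u0: "u0 x \<noteq> 0" and u1: "u1 x \<noteq> 0" for x
    using w0.u_pos[of x] w1.u_pos[of x] by auto
  have fL2: "f \<in> L2" by (rule w0.form_dom_L2[OF f])
  note [measurable] = L2_measurable[OF fL2] has_dist_grad_measurable(2)[OF w0.form_dom_grad[OF f]]
  \<comment> \<open>Both vectors have the same quotient, and the chosen gradient depends on the
    quotient alone, so the two gradients are equal as functions.\<close>
  have quot: "(\<lambda>y. f' y / complex_of_real (u1 y)) = (\<lambda>y. f y / complex_of_real (u0 y))"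
    using u0 u1 by (simp add: f'_def fun_eq_iff)
  then have grad: "w1.grad f' = w0.grad f"
    by (simp add: w0.grad_def w1.grad_def)
  have rs: "0 \<le> u1 x \<and> m * u1 x \<le> u0 x" for x
    using m w1.u_pos[of x] by (simp add: less_imp_le)
  have kin_int: "integrable lebesgue (\<lambda>x. (norm (w0.grad f x))\<^sup>2 * (u1 x)\<^sup>2)"
    and kin_le: "(LINT x|lebesgue. (norm (w0.grad f x))\<^sup>2 * (u1 x)\<^sup>2) \<le>
      (LINT x|lebesgue. (norm (w0.grad f x))\<^sup>2 * (u0 x)\<^sup>2) / m\<^sup>2"
    by (rule integrable_mult_weight_le[OF w0.form_dom_grad_integrable[OF f] _ _ rs \<open>0 < m\<close>]; simp)+
  have sq: "(cmod (f' x))\<^sup>2 = (cmod (f x / u0 x))\<^sup>2 * (u1 x)\<^sup>2"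
    "(cmod (f x))\<^sup>2 = (cmod (f x / u0 x))\<^sup>2 * (u0 x)\<^sup>2" for x
    using u0[of x] by (simp_all add: f'_def norm_mult norm_divide power_mult_distrib power_divide)
  have int_f: "integrable lebesgue (\<lambda>x. (cmod (f x / u0 x))\<^sup>2 * (u0 x)\<^sup>2)"
    using fL2 by (simp add: L2_def sq(2)[symmetric])
  have int_f': "integrable lebesgue (\<lambda>x. (cmod (f x / u0 x))\<^sup>2 * (u1 x)\<^sup>2)"
    and f'_le: "(LINT x|lebesgue. (cmod (f x / u0 x))\<^sup>2 * (u1 x)\<^sup>2) \<le>
      (LINT x|lebesgue. (cmod (f x / u0 x))\<^sup>2 * (u0 x)\<^sup>2) / m\<^sup>2"
    by (rule integrable_mult_weight_le[OF int_f _ _ rs \<open>0 < m\<close>]; simp)+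
  have [measurable]: "f' \<in> borel_measurable lebesgue" unfolding f'_def by measurable
  have f'L2: "f' \<in> L2" using int_f' by (simp add: L2_def sq(1))
  show f': "f' \<in> form_dom u1"
  proof (rule w1.form_domI[OF f'L2])
    show "has_dist_grad (\<lambda>y. f' y / complex_of_real (u1 y)) (w0.grad f)"
      unfolding quot by (rule w0.form_dom_grad[OF f])
  qed (rule kin_int)
  have norm_le: "(L2norm f')\<^sup>2 \<le> (L2norm f)\<^sup>2 / m\<^sup>2"
    using f'_le by (simp add: L2norm_sq sq[symmetric])
  have pot0: "integrable lebesgue (\<lambda>x. V x * (cmod (f x))\<^sup>2)"
    using adm0 f by (simp add: admissible_potential_def)
  have pot1: "integrable lebesgue (\<lambda>x. ?\<beta> * V x * (cmod (f' x))\<^sup>2)"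
    using adm1 f' by (simp add: admissible_potential_def)
  have pot_le: "(LINT x|lebesgue. ?\<beta> * V x * (cmod (f' x))\<^sup>2) \<le> (LINT x|lebesgue. V x * (cmod (f x))\<^sup>2 / m\<^sup>2)"
  proof (rule integral_mono_AE[OF pot1])
    show "integrable lebesgue (\<lambda>x. V x * (cmod (f x))\<^sup>2 / m\<^sup>2)" using pot0 by simp
    show "AE x in lebesgue. ?\<beta> * V x * (cmod (f' x))\<^sup>2 \<le> V x * (cmod (f x))\<^sup>2 / m\<^sup>2"
      using V
    proof eventually_elim
      case (elim x)
      \<comment> \<open>The factor \<open>M\<close> makes up for replacing \<open>u0\<close> by
        \<open>u1\<close>, so \<open>?\<beta>\<close> times the new density dominates the old one
        divided by the square of \<open>m\<close>; the sign of \<open>V\<close> then reverses the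
        inequality.\<close>
      have "(u0 x)\<^sup>2 \<le> (M * u1 x)\<^sup>2"
        using M[of x] w0.u_pos[of x] by (intro power_mono) simp_all
      then have "(cmod (f x / u0 x))\<^sup>2 * (u0 x)\<^sup>2 / m\<^sup>2 \<le> (cmod (f x / u0 x))\<^sup>2 * (M * u1 x)\<^sup>2 / m\<^sup>2"
        by (intro divide_right_mono mult_left_mono) simp_all
      then have "(cmod (f x))\<^sup>2 / m\<^sup>2 \<le> ?\<beta> * (cmod (f' x))\<^sup>2"
        unfolding sq by (simp add: power_mult_distrib power_divide mult_ac)
      then have "V x * (?\<beta> * (cmod (f' x))\<^sup>2) \<le> V x * ((cmod (f x))\<^sup>2 / m\<^sup>2)"
        using elim by (rule mult_left_mono_neg)
      then show ?case by (simp add: mult_ac)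
    qed
  qed
  have "Re (gs_form u1 (\<lambda>x. ?\<beta> * V x) f' f') \<le> Re (gs_form u0 V f f) / m\<^sup>2"
    using kin_le pot_le by (simp add: w0.gs_form_diagonal w1.gs_form_diagonal grad add_divide_distrib)
  also have "\<dots> \<le> l * ((L2norm f)\<^sup>2 / m\<^sup>2)"
    using divide_right_mono[OF le, of "m\<^sup>2"] by simp
  \<comment> \<open>An upper bound on the norm of \<open>f'\<close> helps here precisely because
    \<open>l\<close> is nonpositive.\<close>
  also have "\<dots> \<le> l * (L2norm f')\<^sup>2"
    using norm_le \<open>l \<le> 0\<close> by (rule mult_left_mono_neg)
  finally show "Re (gs_form u1 (\<lambda>x. ?\<beta> * V x) f' f') \<le> l * (L2norm f')\<^sup>2" .
qed

theorem theorem2p1: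
  fixes u0 u1 V :: "real^'n \<Rightarrow> real" and \<beta> :: real and j :: nat
    and P0 P1 :: "real \<Rightarrow> (real^'n \<Rightarrow> complex) \<Rightarrow> (real^'n \<Rightarrow> complex)"
  assumes "continuous_on UNIV u0" and "\<And>x. u0 x > 0"
    and "continuous_on UNIV u1" and "\<And>x. u1 x > 0"
    and "0 < (INF x. u0 x / u1 x)" and "bdd_above (range (\<lambda>x. u0 x / u1 x))"
    and "\<beta> = ((SUP x. u0 x / u1 x) / (INF x. u0 x / u1 x))\<^sup>2"
    and "V \<in> borel_measurable lebesgue" and "AE x in lebesgue. V x \<le> 0"
    and "admissible_potential u0 V" and "admissible_potential u1 (\<lambda>x. \<beta> * V x)"
    and "spectral_family (schroedinger_op u0 V) P0"
    and "spectral_family (schroedinger_op u1 (\<lambda>x. \<beta> * V x)) P1"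
    and "j \<ge> 1"
  shows "\<bar>neg_eigenvalue P0 j\<bar> \<le> \<bar>neg_eigenvalue P1 j\<bar>"
proof -
  define m where "m = (INF x. u0 x / u1 x)"
  define M where "M = (SUP x. u0 x / u1 x)"
  interpret w0: weight u0 using assms by unfold_locales
  interpret w1: weight u1 using assms by unfold_locales
  interpret s0: form_spectral_family "form_dom u0" "gs_form u0 V" P0
    using assms by (intro w0.form_spectral_family_gs_form)
  interpret s1: form_spectral_family "form_dom u1" "gs_form u1 (\<lambda>x. \<beta> * V x)" P1
    using assms by (intro w1.form_spectral_family_gs_form)
  have "m > 0" using assms by (simp add: m_def)
  have "bdd_below (range (\<lambda>x. u0 x / u1 x))"
    using w0.u_pos w1.u_pos by (intro bdd_belowI[of _ 0]) (auto simp: less_imp_le)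
  then have m_le: "m \<le> u0 x / u1 x" for x unfolding m_def by (intro cINF_lower) simp_all
  have le_M: "u0 x / u1 x \<le> M" for x unfolding M_def by (intro cSUP_upper assms(6)) simp
  have mu: "m * u1 x \<le> u0 x" for x
    using m_le[of x] w1.u_pos[of x] by (simp add: pos_le_divide_eq)
  have Mu: "u0 x \<le> M * u1 x" for x
    using le_M[of x] w1.u_pos[of x] by (simp add: pos_divide_le_eq)
  have "0 < M"
    using \<open>0 < m\<close> order_trans[OF m_le[of 0] le_M] by simp
  have \<beta>: "\<beta> = (M / m)\<^sup>2" by (simp add: assms(7) m_def M_def)
  let ?S0 = "{l. dim_ge (P0 l ` L2) j}" and ?S1 = "{l. dim_ge (P1 l ` L2) j}"
  \<comment> \<open>Min-max needs a strict gap between the levels, since equal bounds from above and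
    below would not be contradictory. The infimum does not notice the gap.\<close>
  have step: "l' \<in> ?S1" if "l \<in> ?S0" "l < l'" "l \<le> 0" for l l'
  proof -
    from that(1) obtain v where *: "(\<forall>i<j. v i \<in> P0 l ` L2) \<and>
        (\<forall>c. ae_eq (\<lambda>x. \<Sum>i<j. c i * v i x) (\<lambda>x. 0) \<longrightarrow> (\<forall>i<j. c i = 0))"
      unfolding dim_ge_def mem_Collect_eq by (elim exE)
    note v = *[THEN conjunct1, rule_format] and ind = *[THEN conjunct2, THEN spec, THEN mp]
    \<comment> \<open>Vectors in the range are fixed by the projection up to null functions:
      \<open>P_absorb\<close> with equal parameters.\<close>
    have vL2: "v i \<in> L2" and v_ran: "ae_eq (P0 l (v i)) (v i)" if "i < j" for i
      using v[OF that] s0.P_L2 s0.P_absorb[OF order_refl] by auto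
    define \<rho> where "\<rho> x = complex_of_real (u1 x / u0 x)" for x
    have \<rho>_nz: "\<rho> x \<noteq> 0" for x
      using w0.u_pos[of x] w1.u_pos[of x] by (simp add: \<rho>_def)
    have cmp: "(\<lambda>x. f x * \<rho> x) \<in> form_dom u1"
      "Re (gs_form u1 (\<lambda>x. \<beta> * V x) (\<lambda>x. f x * \<rho> x) (\<lambda>x. f x * \<rho> x)) \<le> l * (L2norm (\<lambda>x. f x * \<rho> x))\<^sup>2"
      if "f \<in> L2" "ae_eq (P0 l f) f" for f
      using form_comparison[OF w0.weight_axioms w1.weight_axioms \<open>0 < m\<close> \<open>0 < M\<close> mu Mu assms(9,10)
          assms(11)[unfolded \<beta>] s0.form_upper_on_range(1)[OF that] \<open>l \<le> 0\<close> s0.form_upper_on_range(2)[OF that]]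
      unfolding \<beta> \<rho>_def .
    have comb_ran: "ae_eq (P0 l (\<lambda>x. \<Sum>i<j. c i * v i x)) (\<lambda>x. \<Sum>i<j. c i * v i x)" for c
    proof -
      have "AE x in lebesgue. \<forall>i\<in>{..<j}. P0 l (v i) x = v i x"
        using v_ran by (intro AE_finite_allI) (auto simp: ae_eq_def)
      then have comb: "ae_eq (\<lambda>x. \<Sum>i<j. c i * P0 l (v i) x) (\<lambda>x. \<Sum>i<j. c i * v i x)"
        unfolding ae_eq_def by eventually_elim simp
      show ?thesis by (rule ae_eq_trans[OF s0.P_sum comb]) (simp add: vL2)
    qed
    have comb_L2: "(\<lambda>x. \<Sum>i<j. c i * v i x) \<in> L2" for c
      by (rule L2_sum) (simp add: vL2)
    have pull: "(\<lambda>x. \<Sum>i<j. c i * (v i x * \<rho> x)) = (\<lambda>x. (\<Sum>i<j. c i * v i x) * \<rho> x)" for c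
      by (simp add: sum_distrib_right mult.assoc)
    have "dim_ge (P1 l' ` L2) j"
    proof (rule s1.dim_ge_if_form_upper[where v = "\<lambda>i x. v i x * \<rho> x", OF \<open>l < l'\<close>], unfold pull)
      show "(\<lambda>x. v i x * \<rho> x) \<in> L2" if "i < j" for i
        using cmp(1)[OF vL2[OF that] v_ran[OF that]] w1.form_dom_L2 by blast
      \<comment> \<open>Multiplication by the nowhere vanishing \<open>\<rho>\<close> creates no new
        null functions, so independence is transported.\<close>
      show "\<forall>i<j. c i = 0" if "ae_eq (\<lambda>x. (\<Sum>i<j. c i * v i x) * \<rho> x) (\<lambda>x. 0)" for c
        using that \<rho>_nz by (intro ind) (simp add: ae_eq_def)
    qed (rule cmp[OF comb_L2 comb_ran])+
    then show ?thesis by simp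
  qed
  show ?thesis
  proof (cases "Inf ?S0 < 0")
    case True
    have "Inf ?S1 \<le> Inf ?S0"
    \<comment> \<open>By density it is enough to test levels \<open>l' < 0\<close>; this keeps
      \<open>l\<close> negative, as the comparison of forms demands.\<close>
    proof (rule dense_ge_bounded[OF True])
      fix l' assume l': "Inf ?S0 < l'" "l' < 0"
      obtain l where "l \<in> ?S0" "l < l'"
        using cInf_lessD[OF _ l'(1)] s0.dim_ge_exists by blast
      then have "l' \<in> ?S1" using step l' by simp
      then show "Inf ?S1 \<le> l'"
        by (rule cInf_lower) (rule s1.bdd_below_dim_ge[OF \<open>j \<ge> 1\<close>])
    qed
    then show ?thesis using True by (simp add: neg_eigenvalue_def)
  next
    \<comment> \<open>The truncation in \<open>neg_eigenvalue\<close> makes the left side 0.\<close>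
    case False
    then show ?thesis by (simp add: neg_eigenvalue_def)
  qed
qed

end
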